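(* Let $\mathcal{M}=\mathcal{M}(\Sigma,I)$ be an irreducible trace monoid. Then: 1. If $\mathbb{P}$ is a Bernoulli measure on the boundary $(\partial\mathcal{M},\mathfrak{F})$ of $\mathcal{M}$, then the valuation $u\in\mathcal{M}\mapsto\mathbb{P}(\uparrow u)$ induced by $\mathbb{P}$ is a Möbius valuation. 2. If $f:\mathcal{M}\to\mathbb{R}_+^*$ is a Möbius valuation, then there exists a unique Bernoulli measure $\mathbb{P}$ on $(\partial\mathcal{M},\mathfrak{F})$ such that $\mathbb{P}(\uparrow u)=f(u)$ for all $u\in\mathcal{M}$.
   Context: Trace monoids. An independence pair $(\Sigma,I)$ consists of a finite non-empty set $\Sigma$ (letters) and an irreflexive symmetric relation $I\subseteq\Sigma\times\Sigma$. The trace monoid is $\mathcal{M}=\mathcal{M}(\Sigma,I)=\langle\Sigma\mid\alpha\cdot\beta=\beta\cdot\alpha\text{ for }(\alpha,\beta)\in I\rangle$; its elements are called traces, its unit is denoted $0$, and $|u|$ is the length of any word representing $u$. It is irreducible if the undirected graph $(\Sigma,D)$, with $D=(\Sigma\times\Sigma)\setminus I$, is connected. Left divisibility: $u\leq v$ iff $v=u\cdot w$ for some $w\in\mathcal{M}$; this is a partial order. Cliques. A clique is a trace of the form $\alpha_1\cdot\ldots\cdot\alpha_n$, $n\geq0$, with $(\alpha_i,\alpha_j)\in I$ for all $i\neq j$; it is identified with the set of its letters. $\mathscr{C}$ is the (finite) set of cliques and $\mathfrak{C}=\mathscr{C}\setminus\{0\}$ the set of non-empty cliques. Boundary. Consider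 non-decreasing sequences $(u_k)_{k\geq0}$ in $(\mathcal{M},\leq)$, pre-ordered by $(u_k)\preccurlyeq(u'_k)$ iff for every $k$ there is $k'$ with $u_k\leq u'_{k'}$. Let $(\mathcal{W},\leq)$ be the partial order obtained by quotienting by the associated equivalence. $\mathcal{M}$ embeds in $\mathcal{W}$ through constant sequences. The boundary is $\partial\mathcal{M}=\mathcal{W}\setminus\mathcal{M}$ (infinite traces). For $u\in\mathcal{M}$, $\uparrow u=\{\xi\in\partial\mathcal{M}: u\leq\xi\}$, and $\mathfrak{F}$ is the $\sigma$-algebra on $\partial\mathcal{M}$ generated by all sets $\uparrow u$, $u\in\mathcal{M}$. Bernoulli measures. A probability measure $\mathbb{P}$ on $(\partial\mathcal{M},\mathfrak{F})$ is Bernoulli if $\mathbb{P}(\uparrow u)>0$ for all $u\in\mathcal{M}$ and $\mathbb{P}(\uparrow(u\cdot v))=\mathbb{P}(\uparrow u)\,\mathbb{P}(\uparrow v)$ for all $u,v\in\mathcal{M}$. Möbius valuations. $\mathbb{R}_+^*$ is the set of positive reals. A valuation is a function $f:\mathcal{M}\to\mathbb{R}_+^*$ with $f(u\cdot v)=f(u)f(v)$ for all $u,v\in\mathcal{M}$. Its Möbius transform is $h:\mathscr{C}\to\mathbb{R}$, $h(c)=\sum_{c'\in\mathscr{C},\,c\leq c'}(-1)^{|c'|-|c|}f(c')$. The valuation $f$ is a Möbius valuation if $h(0)=0$ and $h(c)>0$ for all $c\in\mathfrak{C}$. *)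

theory Defs
  imports "HOL-Probability.Probability" "HOL-Algebra.Divisibility"
begin

locale independence_pair =
  fixes \<Sigma> :: "'a set" and I :: "('a \<times> 'a) set"
  assumes finite_letters: "finite \<Sigma>"
    and letters_nonempty: "\<Sigma> \<noteq> {}"
    and indep_subset: "I \<subseteq> \<Sigma> \<times> \<Sigma>"
    and indep_irrefl: "irrefl I"
    and indep_sym: "sym I"

text \<open>
  The congruence on the free monoid of words over \<open>\<Sigma>\<close> generated by \<open>\<alpha>\<beta> = \<beta>\<alpha>\<close>
  for \<open>(\<alpha>, \<beta>) \<in> I\<close>; a trace is an equivalence class of words.
\<close>

inductive trace_cong :: "'a set \<Rightarrow> ('a \<times> 'a) set \<Rightarrow> 'a list \<Rightarrow> 'a list \<Rightarrow> bool"
  for \<Sigma> I where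
  comm: "(a, b) \<in> I \<Longrightarrow> trace_cong \<Sigma> I [a, b] [b, a]"
| refl: "w \<in> lists \<Sigma> \<Longrightarrow> trace_cong \<Sigma> I w w"
| sym: "trace_cong \<Sigma> I v w \<Longrightarrow> trace_cong \<Sigma> I w v"
| trans: "trace_cong \<Sigma> I u v \<Longrightarrow> trace_cong \<Sigma> I v w \<Longrightarrow> trace_cong \<Sigma> I u w"
| append: "trace_cong \<Sigma> I v w \<Longrightarrow> trace_cong \<Sigma> I v' w' \<Longrightarrow> trace_cong \<Sigma> I (v @ v') (w @ w')"

definition trace_rel :: "'a set \<Rightarrow> ('a \<times> 'a) set \<Rightarrow> ('a list \<times> 'a list) set" where
  "trace_rel \<Sigma> I = {(v, w). trace_cong \<Sigma> I v w}"

definition trace_of :: "'a set \<Rightarrow> ('a \<times> 'a) set \<Rightarrow> 'a list \<Rightarrow> 'a list set" where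
  "trace_of \<Sigma> I w = trace_rel \<Sigma> I `` {w}"

definition trace_monoid :: "'a set \<Rightarrow> ('a \<times> 'a) set \<Rightarrow> 'a list set monoid" where
  "trace_monoid \<Sigma> I =
    \<lparr> carrier = lists \<Sigma> // trace_rel \<Sigma> I,
      mult = (\<lambda>u v. \<Union>x\<in>u. \<Union>y\<in>v. trace_of \<Sigma> I (x @ y)),
      one = trace_of \<Sigma> I [] \<rparr>"

text \<open>All words representing a trace have the same length.\<close>

definition trace_length :: "'a list set \<Rightarrow> nat" where
  "trace_length u = the_elem (length ` u)"

definition irreducible_trace_monoid :: "'a set \<Rightarrow> ('a \<times> 'a) set \<Rightarrow> bool" where
  "irreducible_trace_monoid \<Sigma> I \<longleftrightarrow> (\<forall>a\<in>\<Sigma>. \<forall>b\<in>\<Sigma>. (a, b) \<in> (\<Sigma> \<times> \<Sigma> - I)\<^sup>*)"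

definition trace_cliques :: "'a set \<Rightarrow> ('a \<times> 'a) set \<Rightarrow> 'a list set set" where
  "trace_cliques \<Sigma> I =
    {trace_of \<Sigma> I w | w. w \<in> lists \<Sigma> \<and>
      (\<forall>i<length w. \<forall>j<length w. i \<noteq> j \<longrightarrow> (w ! i, w ! j) \<in> I)}"

text \<open>
  Left divisibility of traces is the relation \<^const>\<open>factor\<close> of the monoid
  (infix \<open>divides\<close>): \<open>u\<close> divides \<open>v\<close> iff \<open>v = u \<otimes> w\<close> for some \<open>w\<close> in the carrier.
\<close>

definition trace_seqs :: "'a set \<Rightarrow> ('a \<times> 'a) set \<Rightarrow> (nat \<Rightarrow> 'a list set) set" where
  "trace_seqs \<Sigma> I =
    {s. range s \<subseteq> carrier (trace_monoid \<Sigma> I) \<and>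
        monotone (\<le>) (factor (trace_monoid \<Sigma> I)) s}"

definition trace_seq_le ::
  "'a set \<Rightarrow> ('a \<times> 'a) set \<Rightarrow> (nat \<Rightarrow> 'a list set) \<Rightarrow> (nat \<Rightarrow> 'a list set) \<Rightarrow> bool" where
  "trace_seq_le \<Sigma> I s t \<longleftrightarrow> (\<forall>k. \<exists>k'. s k divides\<^bsub>trace_monoid \<Sigma> I\<^esub> t k')"

definition trace_seq_rel ::
  "'a set \<Rightarrow> ('a \<times> 'a) set \<Rightarrow> ((nat \<Rightarrow> 'a list set) \<times> (nat \<Rightarrow> 'a list set)) set" where
  "trace_seq_rel \<Sigma> I =
    {(s, t). s \<in> trace_seqs \<Sigma> I \<and> t \<in> trace_seqs \<Sigma> I \<and>
             trace_seq_le \<Sigma> I s t \<and> trace_seq_le \<Sigma> I t s}"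

definition gen_traces :: "'a set \<Rightarrow> ('a \<times> 'a) set \<Rightarrow> (nat \<Rightarrow> 'a list set) set set" where
  "gen_traces \<Sigma> I = trace_seqs \<Sigma> I // trace_seq_rel \<Sigma> I"

definition gen_trace_le ::
  "'a set \<Rightarrow> ('a \<times> 'a) set \<Rightarrow> (nat \<Rightarrow> 'a list set) set \<Rightarrow> (nat \<Rightarrow> 'a list set) set \<Rightarrow> bool" where
  "gen_trace_le \<Sigma> I \<xi> \<eta> \<longleftrightarrow> (\<exists>s\<in>\<xi>. \<exists>t\<in>\<eta>. trace_seq_le \<Sigma> I s t)"

definition trace_embed ::
  "'a set \<Rightarrow> ('a \<times> 'a) set \<Rightarrow> 'a list set \<Rightarrow> (nat \<Rightarrow> 'a list set) set" where
  "trace_embed \<Sigma> I u = trace_seq_rel \<Sigma> I `` {\<lambda>_. u}"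

definition boundary :: "'a set \<Rightarrow> ('a \<times> 'a) set \<Rightarrow> (nat \<Rightarrow> 'a list set) set set" where
  "boundary \<Sigma> I = gen_traces \<Sigma> I - trace_embed \<Sigma> I ` carrier (trace_monoid \<Sigma> I)"

definition cylinder ::
  "'a set \<Rightarrow> ('a \<times> 'a) set \<Rightarrow> 'a list set \<Rightarrow> (nat \<Rightarrow> 'a list set) set set" where
  "cylinder \<Sigma> I u = {\<xi> \<in> boundary \<Sigma> I. gen_trace_le \<Sigma> I (trace_embed \<Sigma> I u) \<xi>}"

text \<open>
  Only the space and the \<open>\<sigma>\<close>-algebra of the following are relevant; as a measure it is
  the null measure.
\<close>

definition boundary_space :: "'a set \<Rightarrow> ('a \<times> 'a) set \<Rightarrow> (nat \<Rightarrow> 'a list set) set measure" where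
  "boundary_space \<Sigma> I =
    sigma (boundary \<Sigma> I) (cylinder \<Sigma> I ` carrier (trace_monoid \<Sigma> I))"

definition bernoulli_measure ::
  "'a set \<Rightarrow> ('a \<times> 'a) set \<Rightarrow> (nat \<Rightarrow> 'a list set) set measure \<Rightarrow> bool" where
  "bernoulli_measure \<Sigma> I P \<longleftrightarrow>
    prob_space P \<and>
    space P = space (boundary_space \<Sigma> I) \<and>
    sets P = sets (boundary_space \<Sigma> I) \<and>
    (\<forall>u\<in>carrier (trace_monoid \<Sigma> I). measure P (cylinder \<Sigma> I u) > 0) \<and>
    (\<forall>u\<in>carrier (trace_monoid \<Sigma> I). \<forall>v\<in>carrier (trace_monoid \<Sigma> I).
      measure P (cylinder \<Sigma> I (u \<otimes>\<^bsub>trace_monoid \<Sigma> I\<^esub> v)) =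
      measure P (cylinder \<Sigma> I u) * measure P (cylinder \<Sigma> I v))"

definition valuation :: "'a set \<Rightarrow> ('a \<times> 'a) set \<Rightarrow> ('a list set \<Rightarrow> real) \<Rightarrow> bool" where
  "valuation \<Sigma> I f \<longleftrightarrow>
    (\<forall>u\<in>carrier (trace_monoid \<Sigma> I). f u > 0) \<and>
    (\<forall>u\<in>carrier (trace_monoid \<Sigma> I). \<forall>v\<in>carrier (trace_monoid \<Sigma> I).
      f (u \<otimes>\<^bsub>trace_monoid \<Sigma> I\<^esub> v) = f u * f v)"

text \<open>The subtraction of lengths is on \<^typ>\<open>nat\<close>, but never truncates since \<open>c\<close> divides \<open>c'\<close>.\<close>

definition moebius_transform ::
  "'a set \<Rightarrow> ('a \<times> 'a) set \<Rightarrow> ('a list set \<Rightarrow> real) \<Rightarrow> 'a list set \<Rightarrow> real" where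
  "moebius_transform \<Sigma> I f c =
    (\<Sum>c' | c' \<in> trace_cliques \<Sigma> I \<and> c divides\<^bsub>trace_monoid \<Sigma> I\<^esub> c'.
      (- 1) ^ (trace_length c' - trace_length c) * f c')"

definition moebius_valuation :: "'a set \<Rightarrow> ('a \<times> 'a) set \<Rightarrow> ('a list set \<Rightarrow> real) \<Rightarrow> bool" where
  "moebius_valuation \<Sigma> I f \<longleftrightarrow>
    valuation \<Sigma> I f \<and>
    moebius_transform \<Sigma> I f \<one>\<^bsub>trace_monoid \<Sigma> I\<^esub> = 0 \<and>
    (\<forall>c\<in>trace_cliques \<Sigma> I - {\<one>\<^bsub>trace_monoid \<Sigma> I\<^esub>}. moebius_transform \<Sigma> I f c > 0)"

end

theory Submission imports Defs "HOL-Library.Sublist" begin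

text \<open>
  A trace is determined by its projections to pairs of dependent letters, and left divisibility is
  the prefix order on all these projections. For a set \<open>N\<close> of letters let
  \<open>m(N) = \<Sum>(-1)^|d| f(d)\<close>, summed over the cliques \<open>d \<subseteq> N\<close>. If \<open>f(u)\<close> is the measure of the
  cylinder of \<open>u\<close>, then inclusion-exclusion gives the measure \<open>f(v) m(N)\<close> to the set of infinite
  traces above \<open>v\<close> but above no \<open>v a\<close> with \<open>a \<in> N\<close>. For \<open>v = 0\<close> and \<open>N = \<Sigma>\<close> this set is
  empty and the measure is \<open>h(0)\<close>; for a clique \<open>c\<close> and the set \<open>N\<close> of letters independent of \<open>c\<close>
  the measure is \<open>h(c)\<close>, and by irreducibility the set contains a whole cylinder.

  Conversely, if \<open>f\<close> is a Moebius valuation then \<open>m(N)\<close> is the sum of \<open>h(c)\<close> over the cliques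
  disjoint from \<open>N\<close>, hence non-negative. So \<open>f(y) m({a. |y|\<^sub>a < n})\<close> are the weights of a probability
  on the finite set of traces containing every letter at most \<open>n\<close> times, under which the traces
  above \<open>u\<close> have probability \<open>f(u)\<close>. Every trace has a largest divisor in that set, these truncations
  make the probabilities consistent, and Kolmogorov's theorem yields the measure on the
  boundary; it does not charge finite traces because \<open>m(\<Sigma>) = h(0) = 0\<close>. Uniqueness holds because
  bounded pairs of traces have least upper bounds, so that cylinders form a \<open>\<pi>\<close>-system.
\<close>

section \<open>Projections and left divisibility\<close>

text \<open>The case \<open>a = b\<close> is included; it records the number of occurrences of a
  single letter.\<close>

definition proj :: "'a \<Rightarrow> 'a \<Rightarrow> 'a list \<Rightarrow> 'a list" where
  "proj a b w = filter (\<lambda>x. x = a \<or> x = b) w"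

lemma proj_simps [simp]:
  "proj a b [] = []"
  "proj a b (x # w) = (if x = a \<or> x = b then x # proj a b w else proj a b w)"
  "proj a b (v @ w) = proj a b v @ proj a b w"
  by (auto simp: proj_def)

lemma proj_commute: "proj a b w = proj b a w"
  by (induction w) auto

lemma set_proj: "set (proj a b w) = set w \<inter> {a, b}"
  by (induction w) auto

lemma proj_eq_Nil_iff: "proj a b w = [] \<longleftrightarrow> a \<notin> set w \<and> b \<notin> set w"
  by (induction w) auto

lemma count_list_proj: "count_list (proj a b w) a = count_list w a"
  by (induction w) auto

declare in_listsD [rule del] in_listsI [rule del]

context independence_pair
begin

abbreviation T :: "'a list \<Rightarrow> 'a list set" where "T \<equiv> trace_of \<Sigma> I"
abbreviation M :: "'a list set monoid" where "M \<equiv> trace_monoid \<Sigma> I"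
abbreviation trace_eq :: "'a list \<Rightarrow> 'a list \<Rightarrow> bool" where "trace_eq \<equiv> trace_cong \<Sigma> I"

definition D :: "('a \<times> 'a) set" where "D = \<Sigma> \<times> \<Sigma> - I"

lemma I_letters: "(a, b) \<in> I \<Longrightarrow> a \<in> \<Sigma> \<and> b \<in> \<Sigma>"
  using indep_subset by auto

lemma I_neq: "(a, a) \<notin> I"
  using indep_irrefl by (auto simp: irrefl_def)

lemma I_sym: "(a, b) \<in> I \<longleftrightarrow> (b, a) \<in> I"
  using indep_sym by (auto simp: sym_def)

lemma D_refl: "a \<in> \<Sigma> \<Longrightarrow> (a, a) \<in> D"
  using I_neq by (auto simp: D_def)

lemma D_sym: "(a, b) \<in> D \<longleftrightarrow> (b, a) \<in> D"
  using I_sym[of a b] by (auto simp: D_def)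

lemma D_letters: "(a, b) \<in> D \<Longrightarrow> a \<in> \<Sigma> \<and> b \<in> \<Sigma>"
  by (auto simp: D_def)

lemma D_iff: "a \<in> \<Sigma> \<Longrightarrow> b \<in> \<Sigma> \<Longrightarrow> (a, b) \<in> D \<longleftrightarrow> (a, b) \<notin> I"
  by (auto simp: D_def)

lemma cong_lists: "trace_eq v w \<Longrightarrow> v \<in> lists \<Sigma> \<and> w \<in> lists \<Sigma>"
  by (induction rule: trace_cong.induct) (auto dest: I_letters)

lemma cong_mset: "trace_eq v w \<Longrightarrow> mset v = mset w"
  by (induction rule: trace_cong.induct) auto

lemma cong_proj: "trace_eq v w \<Longrightarrow> (a, b) \<in> D \<Longrightarrow> proj a b v = proj a b w"
proof (induction rule: trace_cong.induct)
  case (comm c d)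
  then have "(d, c) \<in> I" "c \<noteq> d" using I_sym I_neq by blast+
  with comm show ?case by (auto simp: D_def)
qed auto

lemma cong_commute:
  assumes "a \<in> \<Sigma>" "w \<in> lists \<Sigma>" "\<forall>x\<in>set w. (x, a) \<in> I"
  shows "trace_eq (w @ [a]) (a # w)"
  using assms(2,3)
proof (induction w rule: list.induct)
  case Nil
  show ?case using assms(1) by (auto intro: trace_cong.refl)
next
  case (Cons x w)
  have 1: "trace_eq ([x] @ (w @ [a])) ([x] @ (a # w))"
    using Cons by (intro trace_cong.append trace_cong.refl) auto
  have 2: "trace_eq ([x, a] @ w) ([a, x] @ w)"
    using Cons by (intro trace_cong.append trace_cong.refl trace_cong.comm) auto
  show ?case using trace_cong.trans[of \<Sigma> I, OF 1] 2 by simp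
qed

definition proj_le :: "'a list \<Rightarrow> 'a list \<Rightarrow> bool" where
  "proj_le v w \<longleftrightarrow> (\<forall>a b. (a, b) \<in> D \<longrightarrow> prefix (proj a b v) (proj a b w))"

lemma proj_le_D: "proj_le v w \<Longrightarrow> (a, b) \<in> D \<Longrightarrow> prefix (proj a b v) (proj a b w)"
  by (auto simp: proj_le_def)

text \<open>Induction on \<open>v\<close>. Its first letter \<open>a\<close> occurs in
  \<open>w\<close>, and no letter \<open>b\<close> before the first \<open>a\<close> in
  \<open>w\<close> depends on \<open>a\<close>: otherwise the projection of \<open>w\<close> to the
  two would not begin with \<open>a\<close>. So \<open>a\<close> moves to the front of
  \<open>w\<close> and cancels, and the induction hypothesis applies to the rest.\<close>

lemma proj_le_imp_cong:
  assumes "v \<in> lists \<Sigma>" "w \<in> lists \<Sigma>" "proj_le v w"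
  shows "\<exists>z\<in>lists \<Sigma>. trace_eq (v @ z) w"
  using assms
proof (induction v arbitrary: w rule: list.induct)
  case Nil
  then show ?case by (auto intro: trace_cong.refl)
next
  case (Cons a v)
  have a: "a \<in> \<Sigma>" using Cons by auto
  have "a \<in> set w"
    using proj_le_D[OF Cons.prems(3) D_refl[OF a]] by (auto simp: set_proj dest!: set_mono_prefix)
  then obtain x y where w: "w = x @ a # y" "a \<notin> set x" by (meson split_list_first)
  have *: "(b, a) \<in> I" if b: "b \<in> set x" for b
  proof (rule ccontr)
    assume "(b, a) \<notin> I"
    with b w Cons.prems(2) have ba: "(b, a) \<in> D" by (auto simp: D_def in_lists_conv_set)
    have "prefix (a # proj b a v) (proj b a x @ a # proj b a y)"
      using proj_le_D[OF Cons.prems(3) ba] w by simp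
    moreover have "proj b a x \<noteq> []" using b by (simp add: proj_eq_Nil_iff)
    moreover have "a \<notin> set (proj b a x)" using w by (simp add: set_proj)
    ultimately show False by (cases "proj b a x") auto
  qed
  have "trace_eq ((x @ [a]) @ y) ((a # x) @ y)"
    using Cons.prems w * a by (intro trace_cong.append cong_commute trace_cong.refl) auto
  then have c: "trace_eq w (a # (x @ y))" using w by simp
  have "proj_le v (x @ y)"
    unfolding proj_le_def
  proof clarify
    fix b d assume bD: "(b, d) \<in> D"
    show "prefix (proj b d v) (proj b d (x @ y))"
      using proj_le_D[OF Cons.prems(3) bD] cong_proj[OF c bD] by (auto split: if_splits)
  qed
  then obtain z where z: "z \<in> lists \<Sigma>" "trace_eq (v @ z) (x @ y)"
    using Cons.IH[of "x @ y"] Cons.prems w by auto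
  have "trace_eq ([a] @ (v @ z)) ([a] @ (x @ y))"
    using z a by (intro trace_cong.append[of _ _ "[a]"] trace_cong.refl) auto
  then have "trace_eq ((a # v) @ z) w"
    using trace_cong.trans[OF _ trace_cong.sym[OF c]] by simp
  with z show ?case by auto
qed

text \<open>Equal projections give \<open>proj_le\<close>, hence \<open>w\<close> is congruent to
  some \<open>v @ z\<close>; if \<open>z\<close> began with a letter \<open>a\<close>, the
  projection to \<open>a\<close> alone would be longer for \<open>w\<close> than for
  \<open>v\<close>.\<close>

lemma cong_iff:
  "trace_eq v w \<longleftrightarrow> v \<in> lists \<Sigma> \<and> w \<in> lists \<Sigma> \<and> (\<forall>a b. (a, b) \<in> D \<longrightarrow> proj a b v = proj a b w)"
    (is "?L \<longleftrightarrow> ?R")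
proof
  assume ?L then show ?R using cong_lists cong_proj by auto
next
  assume R: ?R
  then have "proj_le v w" by (auto simp: proj_le_def)
  then obtain z where z: "z \<in> lists \<Sigma>" "trace_eq (v @ z) w" using proj_le_imp_cong[of v w] R by blast
  have "z = []"
  proof (rule ccontr)
    assume "z \<noteq> []"
    then obtain a z' where az: "z = a # z'" by (cases z) auto
    then have "(a, a) \<in> D" using z D_refl by auto
    then show False using cong_proj[OF z(2), of a a] R az by auto
  qed
  with z show ?L by simp
qed

section \<open>Traces as congruence classes: the monoid, divisibility and cancellation\<close>

lemma equiv_trace_rel: "equiv (lists \<Sigma>) (trace_rel \<Sigma> I)"
  by (rule equivI)
    (auto simp: trace_rel_def refl_on_def sym_def trans_def dest: cong_lists
      intro: trace_cong.intros)

lemma T_eq_iff: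
  assumes "v \<in> lists \<Sigma>" "w \<in> lists \<Sigma>"
  shows "T v = T w \<longleftrightarrow> (\<forall>a b. (a, b) \<in> D \<longrightarrow> proj a b v = proj a b w)"
  using eq_equiv_class_iff[OF equiv_trace_rel assms] assms
  unfolding trace_of_def by (simp add: trace_rel_def cong_iff)

lemma in_T: "x \<in> T w \<longleftrightarrow> trace_eq w x"
  by (auto simp: trace_of_def trace_rel_def)

lemma carrier_M: "carrier M = T ` lists \<Sigma>"
  by (auto simp: trace_monoid_def quotient_def trace_of_def)

lemma carrierE:
  assumes "u \<in> carrier M" obtains w where "w \<in> lists \<Sigma>" "u = T w"
  using assms carrier_M by auto

lemma T_carrier [simp]: "w \<in> lists \<Sigma> \<Longrightarrow> T w \<in> carrier M"
  by (simp add: carrier_M)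

lemma one_M: "\<one>\<^bsub>M\<^esub> = T []"
  by (simp add: trace_monoid_def)

text \<open>All products of representatives are congruent, so the union defining the product runs
  over one and the same class.\<close>

lemma mult_T:
  assumes "v \<in> lists \<Sigma>" "w \<in> lists \<Sigma>" shows "T v \<otimes>\<^bsub>M\<^esub> T w = T (v @ w)"
proof -
  have "T (x @ y) = T (v @ w)" if "x \<in> T v" "y \<in> T w" for x y
    using that assms by (auto simp: in_T T_eq_iff cong_iff)
  moreover have "v \<in> T v" "w \<in> T w" using assms by (auto simp: in_T intro: trace_cong.refl)
  ultimately have "(\<Union>x\<in>T v. \<Union>y\<in>T w. T (x @ y)) = T (v @ w)" by blast
  then show ?thesis by (simp add: trace_monoid_def)
qed

lemma monoid_M: "monoid M"
proof
  fix x y z assume "x \<in> carrier M" "y \<in> carrier M" "z \<in> carrier M"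
  then show "x \<otimes>\<^bsub>M\<^esub> y \<otimes>\<^bsub>M\<^esub> z = x \<otimes>\<^bsub>M\<^esub> (y \<otimes>\<^bsub>M\<^esub> z)"
    by (auto elim!: carrierE simp: mult_T)
qed (auto elim!: carrierE simp: mult_T one_M)

lemmas M_closed [simp] = monoid.m_closed[OF monoid_M]
  and M_one_closed [simp] = monoid.one_closed[OF monoid_M]
  and M_l_one [simp] = monoid.l_one[OF monoid_M]
  and M_r_one [simp] = monoid.r_one[OF monoid_M]
  and M_assoc = monoid.m_assoc[OF monoid_M]
  and M_divides_refl = monoid.divides_refl[OF monoid_M]
  and M_divides_trans = monoid.divides_trans[OF monoid_M]

lemma divides_iff:
  assumes "v \<in> lists \<Sigma>" "w \<in> lists \<Sigma>"
  shows "T v divides\<^bsub>M\<^esub> T w \<longleftrightarrow> proj_le v w"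
proof
  assume "T v divides\<^bsub>M\<^esub> T w"
  then obtain z' where "z' \<in> carrier M" and eq: "T w = T v \<otimes>\<^bsub>M\<^esub> z'"
    by (auto simp: factor_def)
  then obtain z where "z \<in> lists \<Sigma>" "z' = T z" using carrierE by metis
  with eq have "z \<in> lists \<Sigma>" "T w = T (v @ z)"
    using assms by (simp_all add: mult_T)
  then show "proj_le v w" using assms by (auto simp: T_eq_iff proj_le_def)
next
  assume "proj_le v w"
  then obtain z where z: "z \<in> lists \<Sigma>" "trace_eq (v @ z) w" using proj_le_imp_cong[of v w] assms by blast
  then have "T w = T v \<otimes>\<^bsub>M\<^esub> T z" using assms by (auto simp: mult_T T_eq_iff cong_iff)
  then show "T v divides\<^bsub>M\<^esub> T w" using z by (auto simp: factor_def)
qed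

lemma proj_le_trans: "proj_le u v \<Longrightarrow> proj_le v w \<Longrightarrow> proj_le u w"
  unfolding proj_le_def using prefix_order.trans by blast

lemma divides_antisym:
  assumes "u \<in> carrier M" "v \<in> carrier M" "u divides\<^bsub>M\<^esub> v" "v divides\<^bsub>M\<^esub> u"
  shows "u = v"
proof -
  obtain u' v' where "u' \<in> lists \<Sigma>" "u = T u'" "v' \<in> lists \<Sigma>" "v = T v'"
    using assms(1,2) carrierE by metis
  then show ?thesis
    using assms(3,4) by (simp add: divides_iff T_eq_iff proj_le_def prefix_order.antisym)
qed

lemma one_divides: "u \<in> carrier M \<Longrightarrow> \<one>\<^bsub>M\<^esub> divides\<^bsub>M\<^esub> u"
  by (rule dividesI[of u]) auto

lemma left_cancel:
  assumes "u \<in> carrier M" "v \<in> carrier M" "w \<in> carrier M" "u \<otimes>\<^bsub>M\<^esub> v = u \<otimes>\<^bsub>M\<^esub> w"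
  shows "v = w"
proof -
  obtain u' v' w' where "u' \<in> lists \<Sigma>" "u = T u'" "v' \<in> lists \<Sigma>" "v = T v'"
    "w' \<in> lists \<Sigma>" "w = T w'"
    using assms(1-3) carrierE by metis
  then show ?thesis using assms(4) by (simp add: mult_T T_eq_iff)
qed

lemma right_cancel:
  assumes "u \<in> carrier M" "v \<in> carrier M" "w \<in> carrier M" "v \<otimes>\<^bsub>M\<^esub> u = w \<otimes>\<^bsub>M\<^esub> u"
  shows "v = w"
proof -
  obtain u' v' w' where "u' \<in> lists \<Sigma>" "u = T u'" "v' \<in> lists \<Sigma>" "v = T v'"
    "w' \<in> lists \<Sigma>" "w = T w'"
    using assms(1-3) carrierE by metis
  then show ?thesis using assms(4) by (simp add: mult_T T_eq_iff)
qed

text \<open>Any representative gives the same count, because congruent words have the same multiset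
  of letters.\<close>

definition letter_count :: "'a list set \<Rightarrow> 'a \<Rightarrow> nat" where
  "letter_count u a = count_list (SOME w. w \<in> u) a"

lemma letter_count_T: assumes "w \<in> lists \<Sigma>" shows "letter_count (T w) a = count_list w a"
proof -
  have "w \<in> T w" using assms by (auto simp: in_T intro: trace_cong.refl)
  then have "(SOME x. x \<in> T w) \<in> T w" by (rule someI)
  then have "mset w = mset (SOME x. x \<in> T w)" by (auto simp: in_T dest: cong_mset)
  then show ?thesis unfolding letter_count_def by (metis count_mset)
qed

lemma letter_count_mult:
  "u \<in> carrier M \<Longrightarrow> v \<in> carrier M \<Longrightarrow> letter_count (u \<otimes>\<^bsub>M\<^esub> v) a = letter_count u a + letter_count v a"
  by (auto elim!: carrierE simp: mult_T letter_count_T)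

lemma letter_count_mono:
  "u \<in> carrier M \<Longrightarrow> v \<in> carrier M \<Longrightarrow> u divides\<^bsub>M\<^esub> v \<Longrightarrow> letter_count u a \<le> letter_count v a"
  by (auto simp: factor_def letter_count_mult)

lemma trace_length_T: assumes "w \<in> lists \<Sigma>" shows "trace_length (T w) = length w"
proof -
  have "w \<in> T w" using assms by (auto simp: in_T intro: trace_cong.refl)
  moreover have "length x = length w" if "x \<in> T w" for x
    using that by (auto simp: in_T dest!: cong_mset mset_eq_length)
  ultimately have "length ` T w = {length w}" by blast
  then show ?thesis by (simp add: trace_length_def)
qed

section \<open>Exchange of letters below a common upper bound\<close>

text \<open>The letter \<open>a\<close> is the first letter of \<open>u\<close> that leads out of the prefixes of \<open>s\<close>; in
  particular it does not depend on the upper bound \<open>x\<close>.\<close>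

lemma exchange_words:
  assumes "u \<in> lists \<Sigma>" "\<not> proj_le u s" "proj_le u x0" "proj_le s x0"
  shows "\<exists>a\<in>\<Sigma>. count_list s a < count_list u a \<and> (\<forall>x. proj_le u x \<longrightarrow> proj_le s x \<longrightarrow> proj_le (s @ [a]) x)"
  using assms
proof (induction u rule: rev_induct)
  case Nil
  then show ?case by (auto simp: proj_le_def)
next
  case (snoc a u)
  have le: "proj_le u (u @ [a])" by (auto simp: proj_le_def)
  show ?case
  proof (cases "proj_le u s")
    case False
    then obtain b where b: "b \<in> \<Sigma>" "count_list s b < count_list u b"
      "\<forall>x. proj_le u x \<longrightarrow> proj_le s x \<longrightarrow> proj_le (s @ [b]) x"
      using snoc proj_le_trans[OF le] by auto
    then show ?thesis using proj_le_trans[OF le] by (intro bexI[of _ b]) auto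
  next
    case True
    have a: "a \<in> \<Sigma>" using snoc by auto
    \<comment> \<open>\<open>proj a b s\<close> and \<open>proj a b u @ [a]\<close> are prefixes of
      the projection of \<open>x\<close>, hence comparable. The second is not a prefix of the first,
      so the first is a prefix of \<open>proj a b u\<close>, and \<open>proj_le u s\<close> gives
      equality.\<close>
    have cmp: "proj a b s = proj a b u"
      if ab: "(a, b) \<in> D" and n: "\<not> prefix (proj a b u @ [a]) (proj a b s)"
        and x: "proj_le (u @ [a]) x" "proj_le s x" for b x
    proof -
      have "prefix (proj a b u @ [a]) (proj a b x)" "prefix (proj a b s) (proj a b x)"
        using proj_le_D[OF x(1) ab] proj_le_D[OF x(2) ab] by auto
      then have "prefix (proj a b s) (proj a b u @ [a])"
        using n prefix_same_cases by blast
      then have "prefix (proj a b s) (proj a b u)" using n by auto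
      then show ?thesis using proj_le_D[OF True ab] by (auto intro: prefix_order.antisym)
    qed
    obtain c d where cd: "(c, d) \<in> D" "\<not> prefix (proj c d (u @ [a])) (proj c d s)"
      using snoc.prems(2) by (auto simp: proj_le_def)
    have "a = c \<or> a = d" using cd proj_le_D[OF True cd(1)] by (auto split: if_splits)
    then obtain b where b: "(a, b) \<in> D" "\<not> prefix (proj a b u @ [a]) (proj a b s)"
    proof
      assume "a = c" then show ?thesis using cd that by auto
    next
      assume "a = d" then show ?thesis using cd that[of c] D_sym[of c d] by (auto simp: proj_commute[of d c])
    qed
    \<comment> \<open>One failing pair already shows that \<open>a\<close> occurs equally often in
      \<open>s\<close> and \<open>u\<close>. So \<open>u @ [a]\<close>, with one more
      \<open>a\<close>, does not fit into \<open>s\<close> at any pair containing \<open>a\<close>,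
      and \<open>cmp\<close> applies to all these pairs.\<close>
    have same: "count_list s a = count_list u a"
      using cmp[OF b snoc.prems(3,4)] count_list_proj by metis
    have eq: "proj a b s = proj a b u" if "(a, b) \<in> D" "proj_le (u @ [a]) x" "proj_le s x" for b x
    proof (rule cmp[OF that(1) _ that(2,3)])
      show "\<not> prefix (proj a b u @ [a]) (proj a b s)"
      proof
        assume "prefix (proj a b u @ [a]) (proj a b s)"
        then obtain z where "proj a b s = proj a b u @ [a] @ z" by (auto simp: prefix_def)
        then have "count_list (proj a b s) a = count_list (proj a b u @ [a] @ z) a" by simp
        then show False using same by (simp add: count_list_proj)
      qed
    qed
    \<comment> \<open>At pairs containing \<open>a\<close> the word \<open>s @ [a]\<close> looks
      like \<open>u @ [a]\<close>, at all other pairs like \<open>s\<close>.\<close>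
    have "proj_le (s @ [a]) x" if x: "proj_le (u @ [a]) x" "proj_le s x" for x
      unfolding proj_le_def
    proof clarify
      fix c d assume cd: "(c, d) \<in> D"
      consider "a = c" | "a = d" | "a \<noteq> c" "a \<noteq> d" by auto
      then show "prefix (proj c d (s @ [a])) (proj c d x)"
      proof cases
        case 1 then show ?thesis using eq[of d, OF _ x] cd proj_le_D[OF x(1) cd] by auto
      next
        case 2 then show ?thesis using eq[of c, OF _ x] D_sym[of c d] cd proj_le_D[OF x(1) cd]
          by (auto simp: proj_commute[of d c])
      next
        case 3 then show ?thesis using proj_le_D[OF x(2) cd] by auto
      qed
    qed
    then show ?thesis using a same by (intro bexI[of _ a]) auto
  qed
qed

text \<open>This turns maximal elements into greatest ones, both for common divisors and for
  truncations. The comparison of counts ensures that \<open>s\<close> followed by \<open>a\<close>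
  respects every letterwise bound that \<open>u\<close> and \<open>s\<close> respect.\<close>

lemma exchange:
  assumes "u \<in> carrier M" "s \<in> carrier M" "x0 \<in> carrier M"
    "\<not> u divides\<^bsub>M\<^esub> s" "u divides\<^bsub>M\<^esub> x0" "s divides\<^bsub>M\<^esub> x0"
  shows "\<exists>a\<in>\<Sigma>. letter_count s a < letter_count u a \<and>
    (\<forall>x\<in>carrier M. u divides\<^bsub>M\<^esub> x \<longrightarrow> s divides\<^bsub>M\<^esub> x \<longrightarrow> s \<otimes>\<^bsub>M\<^esub> T [a] divides\<^bsub>M\<^esub> x)"
proof -
  obtain u' where u: "u' \<in> lists \<Sigma>" "u = T u'" using assms carrierE by metis
  obtain s' where s: "s' \<in> lists \<Sigma>" "s = T s'" using assms carrierE by metis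
  obtain x' where x: "x' \<in> lists \<Sigma>" "x0 = T x'" using assms carrierE by metis
  obtain a where a: "a \<in> \<Sigma>" "count_list s' a < count_list u' a"
    "\<forall>x. proj_le u' x \<longrightarrow> proj_le s' x \<longrightarrow> proj_le (s' @ [a]) x"
    using exchange_words[of u' s' x'] assms u s x by (auto simp: divides_iff)
  show ?thesis
    by (rule bexI[of _ a]) (use a u s in \<open>auto simp: letter_count_T mult_T divides_iff elim!: carrierE\<close>)
qed

text \<open>If \<open>a\<close> and \<open>b\<close> were dependent, both would follow
  \<open>v\<close> in the projection of \<open>x\<close> to the two. If they are independent, no
  dependent pair contains both, so the two divisibility conditions do not interact.\<close>

lemma exchange_letters:
  assumes v: "v \<in> carrier M" and x: "x \<in> carrier M" and ab: "a \<in> \<Sigma>" "b \<in> \<Sigma>" "a \<noteq> b"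
    and d: "v \<otimes>\<^bsub>M\<^esub> T [a] divides\<^bsub>M\<^esub> x" "v \<otimes>\<^bsub>M\<^esub> T [b] divides\<^bsub>M\<^esub> x"
  shows "(a, b) \<in> I \<and> v \<otimes>\<^bsub>M\<^esub> T [b] \<otimes>\<^bsub>M\<^esub> T [a] divides\<^bsub>M\<^esub> x"
proof -
  obtain v' where v': "v' \<in> lists \<Sigma>" "v = T v'" using v carrierE by metis
  obtain x' where x': "x' \<in> lists \<Sigma>" "x = T x'" using x carrierE by metis
  have w: "proj_le (v' @ [a]) x'" "proj_le (v' @ [b]) x'"
    using d v' x' ab by (auto simp: mult_T divides_iff)
  have I: "(a, b) \<in> I"
  proof (rule ccontr)
    assume "(a, b) \<notin> I"
    then have "(a, b) \<in> D" using ab by (simp add: D_iff)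
    from proj_le_D[OF w(1) this] proj_le_D[OF w(2) this] ab(3) show False
      by (auto simp: prefix_def)
  qed
  have "proj_le (v' @ [b, a]) x'"
    unfolding proj_le_def
  proof clarify
    fix c d assume cd: "(c, d) \<in> D"
    then have "\<not> ((a = c \<or> a = d) \<and> (b = c \<or> b = d))" using I ab I_sym[of a b] by (auto simp: D_def)
    then show "prefix (proj c d (v' @ [b, a])) (proj c d x')"
      using proj_le_D[OF w(1) cd] proj_le_D[OF w(2) cd] by (auto split: if_splits)
  qed
  then show ?thesis using I v' x' ab by (simp add: mult_T divides_iff)
qed

end

section \<open>Least upper bounds and truncation\<close>

context independence_pair
begin

lemma trace_length_mult:
  "u \<in> carrier M \<Longrightarrow> v \<in> carrier M \<Longrightarrow>
    trace_length (u \<otimes>\<^bsub>M\<^esub> v) = trace_length u + trace_length v"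
  by (auto elim!: carrierE simp: mult_T trace_length_T)

lemma trace_length_0: "u \<in> carrier M \<Longrightarrow> trace_length u = 0 \<Longrightarrow> u = \<one>\<^bsub>M\<^esub>"
  by (auto elim!: carrierE simp: one_M trace_length_T)

lemma divides_mult [simp]: "u \<in> carrier M \<Longrightarrow> v \<in> carrier M \<Longrightarrow> u divides\<^bsub>M\<^esub> u \<otimes>\<^bsub>M\<^esub> v"
  by (auto simp: factor_def)

lemma divides_length:
  "u \<in> carrier M \<Longrightarrow> v \<in> carrier M \<Longrightarrow> u divides\<^bsub>M\<^esub> v \<Longrightarrow> trace_length u \<le> trace_length v"
  by (auto simp: factor_def trace_length_mult)

lemma divides_length_eq:
  assumes "u \<in> carrier M" "v \<in> carrier M" "u divides\<^bsub>M\<^esub> v" "trace_length v \<le> trace_length u"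
  shows "u = v"
proof -
  obtain z where z: "z \<in> carrier M" "v = u \<otimes>\<^bsub>M\<^esub> z" using assms by (auto simp: factor_def)
  then have "trace_length z = 0" using assms by (simp add: trace_length_mult)
  then have "z = \<one>\<^bsub>M\<^esub>" using z trace_length_0 by blast
  then show ?thesis using z assms by simp
qed

lemma T_single [simp]: "a \<in> \<Sigma> \<Longrightarrow> T [a] \<in> carrier M"
  by simp

lemma trace_length_single [simp]: "a \<in> \<Sigma> \<Longrightarrow> trace_length (T [a]) = 1"
  by (simp add: trace_length_T)

text \<open>Divisors of \<open>w\<close> are at most as long as \<open>w\<close>, so a longest one
  satisfying \<open>P\<close> exists.\<close>

lemma maximal_divisor:
  assumes "w \<in> carrier M" "P \<one>\<^bsub>M\<^esub>"
  obtains s where "s \<in> carrier M" "s divides\<^bsub>M\<^esub> w" "P s"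
    "\<And>a. a \<in> \<Sigma> \<Longrightarrow> s \<otimes>\<^bsub>M\<^esub> T [a] divides\<^bsub>M\<^esub> w \<Longrightarrow> \<not> P (s \<otimes>\<^bsub>M\<^esub> T [a])"
proof -
  let ?Q = "\<lambda>s. s \<in> carrier M \<and> s divides\<^bsub>M\<^esub> w \<and> P s"
  have "?Q \<one>\<^bsub>M\<^esub>" using assms one_divides by auto
  moreover have "\<forall>s. ?Q s \<longrightarrow> trace_length s < Suc (trace_length w)"
    using assms divides_length by (auto simp: less_Suc_eq_le)
  ultimately obtain s where s: "?Q s" "\<forall>t. ?Q t \<longrightarrow> trace_length t \<le> trace_length s"
    using Lattices_Big.ex_has_greatest_nat[of ?Q "\<one>\<^bsub>M\<^esub>" trace_length "Suc (trace_length w)"] by blast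
  have "\<not> P (s \<otimes>\<^bsub>M\<^esub> T [a])" if "a \<in> \<Sigma>" "s \<otimes>\<^bsub>M\<^esub> T [a] divides\<^bsub>M\<^esub> w" for a
    using s(2)[rule_format, of "s \<otimes>\<^bsub>M\<^esub> T [a]"] s(1) that by (auto simp: trace_length_mult)
  then show thesis using s that by blast
qed

text \<open>A common upper bound \<open>w\<close> of minimal length is least: for another one,
  \<open>x\<close>, a maximal common divisor \<open>s\<close> of \<open>w\<close> and
  \<open>x\<close> is by \<open>exchange\<close> the greatest. Hence \<open>u\<close> and
  \<open>v\<close> divide \<open>s\<close>, and minimality of the length forces
  \<open>s = w\<close>.\<close>

lemma lub_exists:
  assumes uv: "u \<in> carrier M" "v \<in> carrier M" and x0: "x0 \<in> carrier M"
    "u divides\<^bsub>M\<^esub> x0" "v divides\<^bsub>M\<^esub> x0"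
  shows "\<exists>w\<in>carrier M. \<forall>x\<in>carrier M. w divides\<^bsub>M\<^esub> x \<longleftrightarrow> u divides\<^bsub>M\<^esub> x \<and> v divides\<^bsub>M\<^esub> x"
proof -
  let ?Q = "\<lambda>s. s \<in> carrier M \<and> u divides\<^bsub>M\<^esub> s \<and> v divides\<^bsub>M\<^esub> s"
  obtain w where w: "?Q w" "\<forall>t. ?Q t \<longrightarrow> trace_length w \<le> trace_length t"
    using x0 ex_has_least_nat[of ?Q x0 trace_length] by blast
  have "w divides\<^bsub>M\<^esub> x" if x: "?Q x" for x
  proof -
    obtain s where s: "s \<in> carrier M" "s divides\<^bsub>M\<^esub> w" "s divides\<^bsub>M\<^esub> x"
      "\<And>a. a \<in> \<Sigma> \<Longrightarrow> s \<otimes>\<^bsub>M\<^esub> T [a] divides\<^bsub>M\<^esub> w \<Longrightarrow> \<not> s \<otimes>\<^bsub>M\<^esub> T [a] divides\<^bsub>M\<^esub> x"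
      using maximal_divisor[of w "\<lambda>s. s divides\<^bsub>M\<^esub> x"] w x one_divides by metis
    have *: "t divides\<^bsub>M\<^esub> s"
      if t: "t \<in> carrier M" "t divides\<^bsub>M\<^esub> w" "t divides\<^bsub>M\<^esub> x" for t
    proof (rule ccontr)
      assume n: "\<not> t divides\<^bsub>M\<^esub> s"
      obtain a where a: "a \<in> \<Sigma>" "\<And>x. x \<in> carrier M \<Longrightarrow> t divides\<^bsub>M\<^esub> x \<Longrightarrow> s divides\<^bsub>M\<^esub> x \<Longrightarrow>
          s \<otimes>\<^bsub>M\<^esub> T [a] divides\<^bsub>M\<^esub> x"
        using exchange[OF t(1) s(1) conjunct1[OF w(1)] n t(2) s(2)] by auto
      show False using s(4)[OF a(1)] a(2)[of w] a(2)[of x] w(1) x t s(2,3) by simp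
    qed
    have "u divides\<^bsub>M\<^esub> s" "v divides\<^bsub>M\<^esub> s" using * uv w(1) x by simp_all
    then have "trace_length w \<le> trace_length s" using w(2) s(1) by simp
    then have "s = w" using divides_length_eq s(1,2) w(1) by simp
    then show ?thesis using s by simp
  qed
  moreover have "u divides\<^bsub>M\<^esub> x" "v divides\<^bsub>M\<^esub> x" if "w divides\<^bsub>M\<^esub> x" for x
    using that M_divides_trans[of _ w x] uv w(1) by simp_all
  ultimately have "\<forall>x\<in>carrier M. w divides\<^bsub>M\<^esub> x \<longleftrightarrow> u divides\<^bsub>M\<^esub> x \<and> v divides\<^bsub>M\<^esub> x" by meson
  then show ?thesis using w(1) by meson
qed

section \<open>Traces with bounded letter counts, and truncation\<close>

text \<open>Bounding every letter separately lets the exchange step stay inside the set, so that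
  greatest divisors exist. The bound depends on the letter because cancelling a prefix
  \<open>u\<close> lowers it by \<open>letter_count u a\<close>.\<close>

definition bounded_traces :: "('a \<Rightarrow> nat) \<Rightarrow> 'a list set set" where
  "bounded_traces K = {u \<in> carrier M. \<forall>a\<in>\<Sigma>. letter_count u a \<le> K a}"

lemma bounded_traces_carrier: "u \<in> bounded_traces K \<Longrightarrow> u \<in> carrier M"
  by (auto simp: bounded_traces_def)

lemma finite_bounded_traces: "finite (bounded_traces K)"
proof -
  have "bounded_traces K \<subseteq> T ` {w. set w \<subseteq> \<Sigma> \<and> length w \<le> sum K \<Sigma>}"
  proof
    fix u assume u: "u \<in> bounded_traces K"
    then obtain w where w: "w \<in> lists \<Sigma>" "u = T w" using bounded_traces_carrier carrierE by metis
    then have "length w = (\<Sum>a\<in>\<Sigma>. count_list w a)"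
      using sum_count_set[of w \<Sigma>] finite_letters by (simp add: in_lists_conv_set subset_iff)
    also have "\<dots> \<le> sum K \<Sigma>" using u w by (intro sum_mono) (auto simp: bounded_traces_def letter_count_T)
    finally show "u \<in> T ` {w. set w \<subseteq> \<Sigma> \<and> length w \<le> sum K \<Sigma>}"
      using w by (auto simp: in_lists_conv_set)
  qed
  then show ?thesis using finite_lists_length_le[OF finite_letters] finite_subset by blast
qed

lemma one_bounded_traces: "\<one>\<^bsub>M\<^esub> \<in> bounded_traces K"
  by (auto simp: bounded_traces_def one_M letter_count_T)

text \<open>A maximal divisor \<open>s\<close> of \<open>x\<close> in the set is the greatest: if
  \<open>u\<close> did not divide it, \<open>exchange\<close> would add to \<open>s\<close> a letter
  that occurs in \<open>s\<close> less often than in \<open>u\<close>, which stays within the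
  bounds.\<close>

lemma trunc_exists:
  assumes x: "x \<in> carrier M"
  shows "\<exists>y. y \<in> bounded_traces K \<and> y divides\<^bsub>M\<^esub> x \<and> (\<forall>u\<in>bounded_traces K. u divides\<^bsub>M\<^esub> x \<longrightarrow> u divides\<^bsub>M\<^esub> y)"
proof -
  obtain s where s: "s \<in> carrier M" "s divides\<^bsub>M\<^esub> x" "s \<in> bounded_traces K"
    "\<And>a. a \<in> \<Sigma> \<Longrightarrow> s \<otimes>\<^bsub>M\<^esub> T [a] divides\<^bsub>M\<^esub> x \<Longrightarrow> s \<otimes>\<^bsub>M\<^esub> T [a] \<notin> bounded_traces K"
    using maximal_divisor[of x "\<lambda>s. s \<in> bounded_traces K"] x one_bounded_traces by metis
  have "u divides\<^bsub>M\<^esub> s" if u: "u \<in> bounded_traces K" "u divides\<^bsub>M\<^esub> x" for u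
  proof (rule ccontr)
    assume "\<not> u divides\<^bsub>M\<^esub> s"
    then obtain a where a: "a \<in> \<Sigma>" "letter_count s a < letter_count u a" "s \<otimes>\<^bsub>M\<^esub> T [a] divides\<^bsub>M\<^esub> x"
      using exchange[of u s x] u s x bounded_traces_carrier[OF u(1)] by auto
    have "letter_count (s \<otimes>\<^bsub>M\<^esub> T [a]) b \<le> K b" if "b \<in> \<Sigma>" for b
    proof -
      have "letter_count u b \<le> K b" "letter_count s b \<le> K b" using u s that by (auto simp: bounded_traces_def)
      then show ?thesis using a s by (auto simp: letter_count_mult letter_count_T)
    qed
    then have "s \<otimes>\<^bsub>M\<^esub> T [a] \<in> bounded_traces K" using s a by (auto simp: bounded_traces_def)
    then show False using s a by blast
  qed
  then show ?thesis using s by blast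
qed

definition trunc :: "('a \<Rightarrow> nat) \<Rightarrow> 'a list set \<Rightarrow> 'a list set" where
  "trunc K x =
    (SOME y. y \<in> bounded_traces K \<and> y divides\<^bsub>M\<^esub> x \<and> (\<forall>u\<in>bounded_traces K. u divides\<^bsub>M\<^esub> x \<longrightarrow> u divides\<^bsub>M\<^esub> y))"

lemma trunc:
  assumes "x \<in> carrier M"
  shows trunc_bounded_traces: "trunc K x \<in> bounded_traces K" and trunc_divides: "trunc K x divides\<^bsub>M\<^esub> x"
    and trunc_greatest: "\<And>u. u \<in> bounded_traces K \<Longrightarrow> u divides\<^bsub>M\<^esub> x \<Longrightarrow> u divides\<^bsub>M\<^esub> trunc K x"
  using someI_ex[OF trunc_exists[OF assms, of K], folded trunc_def] by auto

lemma divides_trunc_iff: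
  assumes "x \<in> carrier M" "u \<in> bounded_traces K"
  shows "u divides\<^bsub>M\<^esub> trunc K x \<longleftrightarrow> u divides\<^bsub>M\<^esub> x"
  using assms trunc_greatest trunc_divides M_divides_trans bounded_traces_carrier by blast

lemma trunc_eqI:
  assumes "x \<in> carrier M" "y \<in> bounded_traces K" "\<And>u. u \<in> bounded_traces K \<Longrightarrow> u divides\<^bsub>M\<^esub> x \<longleftrightarrow> u divides\<^bsub>M\<^esub> y"
  shows "trunc K x = y"
  using assms trunc_bounded_traces[of x K] by (metis bounded_traces_carrier divides_antisym divides_trunc_iff M_divides_refl)

lemma bounded_traces_mono: "K \<le> K' \<Longrightarrow> bounded_traces K \<subseteq> bounded_traces K'"
  by (auto simp: bounded_traces_def le_fun_def intro: order_trans)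

lemma trunc_trunc:
  assumes "x \<in> carrier M" "K \<le> K'" shows "trunc K (trunc K' x) = trunc K x"
proof (rule trunc_eqI)
  show "u divides\<^bsub>M\<^esub> trunc K' x \<longleftrightarrow> u divides\<^bsub>M\<^esub> trunc K x" if "u \<in> bounded_traces K" for u
    using assms that bounded_traces_mono[OF assms(2)] divides_trunc_iff by blast
qed (use assms trunc_bounded_traces bounded_traces_carrier in auto)

section \<open>Letters in which a trace can end\<close>

definition last_letters :: "'a list set \<Rightarrow> 'a set" where
  "last_letters z = {a \<in> \<Sigma>. \<exists>y\<in>carrier M. z = y \<otimes>\<^bsub>M\<^esub> T [a]}"

text \<open>If all projections involving \<open>a\<close> end with \<open>a\<close>, no letter after
  the last \<open>a\<close> in \<open>w\<close> depends on \<open>a\<close>, so that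
  \<open>a\<close> commutes to the end.\<close>

lemma last_letters_T:
  assumes w: "w \<in> lists \<Sigma>"
  shows "last_letters (T w) = {a \<in> \<Sigma>. \<forall>b. (a, b) \<in> D \<longrightarrow> suffix [a] (proj a b w)}"
proof (intro equalityI subsetI)
  fix a assume "a \<in> last_letters (T w)"
  then obtain y where a: "a \<in> \<Sigma>" and y: "y \<in> carrier M" "T w = y \<otimes>\<^bsub>M\<^esub> T [a]"
    by (auto simp: last_letters_def)
  then obtain y' where y': "y' \<in> lists \<Sigma>" "y = T y'" using carrierE by metis
  then have "T w = T (y' @ [a])" using y a by (simp add: mult_T)
  then show "a \<in> {a \<in> \<Sigma>. \<forall>b. (a, b) \<in> D \<longrightarrow> suffix [a] (proj a b w)}"
    using w a y' by (simp add: T_eq_iff suffix_def)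
next
  fix a assume "a \<in> {a \<in> \<Sigma>. \<forall>b. (a, b) \<in> D \<longrightarrow> suffix [a] (proj a b w)}"
  then have a: "a \<in> \<Sigma>" and suf: "\<And>b. (a, b) \<in> D \<Longrightarrow> suffix [a] (proj a b w)" by auto
  have "a \<in> set (proj a a w)" using suf[OF D_refl[OF a]] by (auto simp: suffix_def)
  then have "a \<in> set w" by (simp add: set_proj)
  then obtain p q where pq: "w = p @ a # q" "a \<notin> set q" by (meson split_list_last)
  have *: "(b, a) \<in> I" if b: "b \<in> set q" for b
  proof (rule ccontr)
    assume "(b, a) \<notin> I"
    with b pq w a have "(a, b) \<in> D" using I_sym[of a b] by (auto simp: D_def in_lists_conv_set)
    from suf[OF this] obtain r where r: "proj a b p @ a # proj a b q = r @ [a]"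
      using pq by (auto simp: suffix_def)
    have ne: "proj a b q \<noteq> []" using b by (simp add: proj_eq_Nil_iff)
    have "last (proj a b q) = last (proj a b p @ a # proj a b q)" using ne by simp
    also have "\<dots> = a" unfolding r by simp
    finally have "a \<in> set (proj a b q)" using ne last_in_set by metis
    then show False using pq by (simp add: set_proj)
  qed
  have "trace_eq (p @ (q @ [a])) (p @ (a # q))"
    using w pq * a by (intro trace_cong.append[of _ _ p p] cong_commute trace_cong.refl) auto
  then have "T w = T (p @ q @ [a])" using pq by (simp add: T_eq_iff cong_iff)
  also have "\<dots> = T (p @ q) \<otimes>\<^bsub>M\<^esub> T [a]" using w pq a by (simp add: mult_T)
  finally show "a \<in> last_letters (T w)" using w pq a by (auto simp: last_letters_def)
qed

text \<open>Two dependent last letters would both end the projection to the pair.\<close>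

lemma last_letters_indep:
  assumes "z \<in> carrier M" "a \<in> last_letters z" "b \<in> last_letters z" "a \<noteq> b" shows "(a, b) \<in> I"
proof (rule ccontr)
  assume n: "(a, b) \<notin> I"
  obtain w where w: "w \<in> lists \<Sigma>" "z = T w" using assms carrierE by metis
  have ab: "(a, b) \<in> D" using n assms by (auto simp: D_def last_letters_def)
  then have "suffix [a] (proj a b w)" "suffix [b] (proj a b w)"
    using assms w D_sym[of a b] proj_commute[of a b w] by (auto simp: last_letters_T)
  then show False using assms(4) by (auto simp: suffix_def)
qed

text \<open>Whether \<open>a\<close> is a last letter is tested on dependent pairs containing
  \<open>a\<close>, and none of these contains \<open>b\<close>.\<close>

lemma last_letters_mult_single:
  assumes "y \<in> carrier M" "(a, b) \<in> I"
  shows "a \<in> last_letters (y \<otimes>\<^bsub>M\<^esub> T [b]) \<longleftrightarrow> a \<in> last_letters y"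
proof -
  obtain w where w: "w \<in> lists \<Sigma>" "y = T w" using assms carrierE by metis
  have ab: "a \<in> \<Sigma>" "b \<in> \<Sigma>" "a \<noteq> b" using assms I_letters I_neq by auto
  have "proj a c (w @ [b]) = proj a c w" if "(a, c) \<in> D" for c
    using that assms(2) ab by (auto simp: D_def)
  then show ?thesis using w ab by (simp add: mult_T last_letters_T del: proj_simps)
qed

lemma last_letters_empty:
  assumes "z \<in> carrier M" "last_letters z = {}" shows "z = \<one>\<^bsub>M\<^esub>"
proof -
  obtain w where w: "w \<in> lists \<Sigma>" "z = T w" using assms carrierE by metis
  show ?thesis
  proof (cases w rule: rev_exhaust)
    case Nil then show ?thesis using w by (simp add: one_M)
  next
    case (snoc v a)
    then have "z = T v \<otimes>\<^bsub>M\<^esub> T [a]" "a \<in> \<Sigma>" "T v \<in> carrier M" using w by (auto simp: mult_T)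
    then have "a \<in> last_letters z" by (auto simp: last_letters_def)
    with assms show ?thesis by auto
  qed
qed

lemma last_letters_one: "last_letters \<one>\<^bsub>M\<^esub> = {}"
  by (auto simp: one_M last_letters_T dest: D_refl)

section \<open>The clique polynomial\<close>

definition clique_set :: "'a set \<Rightarrow> bool" where
  "clique_set d \<longleftrightarrow> d \<subseteq> \<Sigma> \<and> (\<forall>a\<in>d. \<forall>b\<in>d. a \<noteq> b \<longrightarrow> (a, b) \<in> I)"

lemma clique_set_finite: "clique_set d \<Longrightarrow> finite d"
  using finite_letters finite_subset by (auto simp: clique_set_def)

lemma finite_clique_set: "finite {d. clique_set d \<and> P d}"
  by (rule finite_subset[of _ "Pow \<Sigma>"]) (auto simp: clique_set_def finite_letters)

text \<open>This is \<open>m(N)\<close> of the overview: the multivariate clique polynomial of the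
  graph \<open>I\<close> restricted to \<open>N\<close>, evaluated at the negated weights.\<close>

definition clique_poly :: "('a \<Rightarrow> real) \<Rightarrow> 'a set \<Rightarrow> real" where
  "clique_poly \<phi> N = (\<Sum>d | clique_set d \<and> d \<subseteq> N. \<Prod>a\<in>d. - \<phi> a)"

lemma clique_poly_empty [simp]: "clique_poly \<phi> {} = 1"
proof -
  have "{d. clique_set d \<and> d \<subseteq> {}} = {{}}" by (auto simp: clique_set_def)
  then show ?thesis by (simp add: clique_poly_def)
qed

text \<open>The cliques containing \<open>b\<close> arise by adding \<open>b\<close> to a clique of
  letters of \<open>N\<close> independent of \<open>b\<close>, which contributes the factor
  \<open>- \<phi> b\<close>. The inductions on \<open>N\<close> below follow this recursion.\<close>

lemma clique_poly_insert:
  assumes "b \<in> \<Sigma>" "b \<notin> N"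
  shows "clique_poly \<phi> (insert b N) = clique_poly \<phi> N - \<phi> b * clique_poly \<phi> (N \<inter> {a. (a, b) \<in> I})"
proof -
  let ?A = "{d. clique_set d \<and> d \<subseteq> N}" and ?B = "{d. clique_set d \<and> d \<subseteq> N \<inter> {a. (a, b) \<in> I}}"
  have eq: "{d. clique_set d \<and> d \<subseteq> insert b N} = ?A \<union> insert b ` ?B"
  proof (intro equalityI subsetI)
    fix d assume d: "d \<in> {d. clique_set d \<and> d \<subseteq> insert b N}"
    show "d \<in> ?A \<union> insert b ` ?B"
    proof (cases "b \<in> d")
      case True
      then have "d = insert b (d - {b})" by auto
      moreover have "d - {b} \<in> ?B" using d True by (auto simp: clique_set_def)
      ultimately show ?thesis by blast
    qed (use d in auto)
  next
    fix d assume "d \<in> ?A \<union> insert b ` ?B"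
    then show "d \<in> {d. clique_set d \<and> d \<subseteq> insert b N}"
      using assms I_sym by (fastforce simp: clique_set_def)
  qed
  have inj: "inj_on (insert b) ?B" using assms by (intro inj_onI) (auto simp: insert_eq_iff)
  have "clique_poly \<phi> (insert b N) =
      (\<Sum>d\<in>?A. \<Prod>a\<in>d. - \<phi> a) + (\<Sum>d\<in>insert b ` ?B. \<Prod>a\<in>d. - \<phi> a)"
    unfolding clique_poly_def eq using assms by (intro sum.union_disjoint finite_imageI finite_clique_set) auto
  also have "(\<Sum>d\<in>insert b ` ?B. \<Prod>a\<in>d. - \<phi> a) = (\<Sum>d\<in>?B. - \<phi> b * (\<Prod>a\<in>d. - \<phi> a))"
    unfolding sum.reindex[OF inj] comp_def
  proof (rule sum.cong[OF HOL.refl])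
    fix d assume "d \<in> ?B"
    then have "finite d" "b \<notin> d" using assms clique_set_finite by auto
    then show "(\<Prod>a\<in>insert b d. - \<phi> a) = - \<phi> b * (\<Prod>a\<in>d. - \<phi> a)" by simp
  qed
  finally show ?thesis by (simp add: clique_poly_def sum_distrib_left sum_negf)
qed

section \<open>Sums of the weights over bounded traces\<close>

lemma valuation_one: assumes "valuation \<Sigma> I f" shows "f \<one>\<^bsub>M\<^esub> = 1"
proof -
  have "f (\<one>\<^bsub>M\<^esub> \<otimes>\<^bsub>M\<^esub> \<one>\<^bsub>M\<^esub>) = f \<one>\<^bsub>M\<^esub> * f \<one>\<^bsub>M\<^esub>" "f \<one>\<^bsub>M\<^esub> > 0"
    using assms M_one_closed unfolding valuation_def by blast+
  then show ?thesis by simp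
qed

lemma valuation_mult:
  "valuation \<Sigma> I f \<Longrightarrow> u \<in> carrier M \<Longrightarrow> v \<in> carrier M \<Longrightarrow> f (u \<otimes>\<^bsub>M\<^esub> v) = f u * f v"
  by (auto simp: valuation_def)

text \<open>For \<open>N = \<Sigma>\<close> and \<open>X = {}\<close> only the empty trace survives on the right-hand side; the general
  form is what makes the induction on \<open>N\<close> work.\<close>

lemma sum_bounded_traces_clique_poly_last_letters:
  assumes f: "valuation \<Sigma> I f" and "N \<subseteq> \<Sigma>" and "\<forall>a\<in>N. \<forall>x\<in>X. (a, x) \<in> I"
  defines "\<phi> \<equiv> \<lambda>a. f (T [a])"
  shows "(\<Sum>w | w \<in> bounded_traces K \<and> X \<subseteq> last_letters w. f w * clique_poly \<phi> (N \<inter> {a. letter_count w a < K a})) =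
    (\<Sum>w | w \<in> bounded_traces K \<and> X \<subseteq> last_letters w \<and> last_letters w \<inter> N = {}. f w)"
proof -
  have "finite N" using assms(2) finite_letters finite_subset by auto
  then show ?thesis using assms(2,3)
  proof (induction "card N" arbitrary: N X rule: less_induct)
    case less
    show ?case
    proof (cases "N = {}")
      case True then show ?thesis by simp
    next
      case False
      then obtain b where b: "b \<in> N" by auto
      define L where "L = N - {b}"
      define Ib where "Ib = {a. (a, b) \<in> I}"
      have N: "N = insert b L" "b \<notin> L" "b \<in> \<Sigma>" using b less by (auto simp: L_def)
      have card: "card L < card N" "card (L \<inter> Ib) < card N"
        using b less.prems(1) unfolding L_def by (blast intro!: psubset_card_mono)+
      define A where "A w = {a. letter_count w a < K a}" for w
      let ?W = "{w. w \<in> bounded_traces K \<and> X \<subseteq> last_letters w}"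
      \<comment> \<open>To the traces in \<open>?V\<close> one more \<open>b\<close> can be appended
        within the bounds; \<open>?Z\<close> is going to be the set of results.\<close>
      let ?V = "{w. w \<in> bounded_traces K \<and> X \<subseteq> last_letters w \<and> letter_count w b < K b}"
      let ?Z = "{w. w \<in> bounded_traces K \<and> insert b X \<subseteq> last_letters w}"
      have finW: "finite ?W" using finite_bounded_traces finite_subset[of ?W "bounded_traces K"] by auto
      \<comment> \<open>If \<open>b\<close> has reached its bound, it is missing from
        \<open>N \<inter> A w\<close> and there is no second term.\<close>
      have split: "clique_poly \<phi> (N \<inter> A w) = clique_poly \<phi> (L \<inter> A w) -
          (if letter_count w b < K b then \<phi> b * clique_poly \<phi> (L \<inter> Ib \<inter> A w) else 0)" for w
      proof (cases "letter_count w b < K b")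
        case True
        then have "N \<inter> A w = insert b (L \<inter> A w)" using N by (auto simp: A_def)
        then show ?thesis using clique_poly_insert[of b "L \<inter> A w" \<phi>] N True
          by (simp add: Ib_def Int_ac)
      next
        case False
        then have "N \<inter> A w = L \<inter> A w" using N by (auto simp: A_def)
        then show ?thesis using False by simp
      qed
      have "(\<Sum>w\<in>?W. f w * clique_poly \<phi> (N \<inter> A w)) =
          (\<Sum>w\<in>?W. f w * clique_poly \<phi> (L \<inter> A w)) -
          (\<Sum>w\<in>?W. if letter_count w b < K b then f w * (\<phi> b * clique_poly \<phi> (L \<inter> Ib \<inter> A w)) else 0)"
        unfolding split sum_subtractf[symmetric] by (intro sum.cong) (auto simp: algebra_simps)
      also have "(\<Sum>w\<in>?W. if letter_count w b < K b then f w * (\<phi> b * clique_poly \<phi> (L \<inter> Ib \<inter> A w)) else 0) =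
          (\<Sum>w\<in>?V. f w * (\<phi> b * clique_poly \<phi> (L \<inter> Ib \<inter> A w)))"
        using finW by (subst sum.inter_filter[symmetric]) (auto intro!: sum.cong)
      \<comment> \<open>The factor \<open>\<phi> b\<close> is absorbed by \<open>f\<close>, and
        appending \<open>b\<close> changes the count of no letter in
        \<open>L \<inter> Ib\<close>.\<close>
      also have "\<dots> = (\<Sum>w\<in>?V. f (w \<otimes>\<^bsub>M\<^esub> T [b]) * clique_poly \<phi> (L \<inter> Ib \<inter> A (w \<otimes>\<^bsub>M\<^esub> T [b])))"
      proof (rule sum.cong[OF HOL.refl])
        fix w assume "w \<in> ?V"
        then have wc: "w \<in> carrier M" using bounded_traces_carrier by auto
        have "L \<inter> Ib \<inter> A (w \<otimes>\<^bsub>M\<^esub> T [b]) = L \<inter> Ib \<inter> A w"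
          using wc N(3) I_neq by (auto simp: A_def Ib_def letter_count_mult letter_count_T)
        then show "f w * (\<phi> b * clique_poly \<phi> (L \<inter> Ib \<inter> A w)) =
            f (w \<otimes>\<^bsub>M\<^esub> T [b]) * clique_poly \<phi> (L \<inter> Ib \<inter> A (w \<otimes>\<^bsub>M\<^esub> T [b]))"
          using valuation_mult[OF f wc] N(3) by (simp add: \<phi>_def)
      qed
      also have "\<dots> = (\<Sum>z\<in>?Z. f z * clique_poly \<phi> (L \<inter> Ib \<inter> A z))"
      proof (rule sum.reindex_bij_betw)
        \<comment> \<open>As all of \<open>X\<close> is independent of \<open>b\<close>, appending
          or removing a final \<open>b\<close> does not affect whether the letters of
          \<open>X\<close> are last letters.\<close>
        have Xb: "(x, b) \<in> I" if "x \<in> X" for x using that less.prems(3) b I_sym by blast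
        show "bij_betw (\<lambda>w. w \<otimes>\<^bsub>M\<^esub> T [b]) ?V ?Z"
        proof (rule bij_betwI')
          fix w v assume "w \<in> ?V" "v \<in> ?V"
          then show "(w \<otimes>\<^bsub>M\<^esub> T [b] = v \<otimes>\<^bsub>M\<^esub> T [b]) = (w = v)"
            using right_cancel[of "T [b]" w v] N(3) bounded_traces_carrier by auto
        next
          fix w assume w: "w \<in> ?V"
          then have wc: "w \<in> carrier M" using bounded_traces_carrier by auto
          have "w \<otimes>\<^bsub>M\<^esub> T [b] \<in> bounded_traces K" using w wc N(3) by (auto simp: bounded_traces_def letter_count_mult letter_count_T)
          moreover have "b \<in> last_letters (w \<otimes>\<^bsub>M\<^esub> T [b])" using wc N(3) by (auto simp: last_letters_def)
          moreover have "X \<subseteq> last_letters (w \<otimes>\<^bsub>M\<^esub> T [b])"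
            using w last_letters_mult_single[OF wc Xb] by auto
          ultimately show "w \<otimes>\<^bsub>M\<^esub> T [b] \<in> ?Z" by auto
        next
          fix z assume z: "z \<in> ?Z"
          then obtain w where w: "w \<in> carrier M" "z = w \<otimes>\<^bsub>M\<^esub> T [b]" by (auto simp: last_letters_def)
          have le: "letter_count w a + count_list [b] a \<le> K a" if "a \<in> \<Sigma>" for a
            using z w that N(3) by (auto simp: bounded_traces_def letter_count_mult letter_count_T)
          have "w \<in> bounded_traces K" using le w(1) by (auto simp: bounded_traces_def intro: add_leD1)
          moreover have "X \<subseteq> last_letters w" using z w last_letters_mult_single[OF w(1) Xb] by auto
          moreover have "letter_count w b < K b" using le[OF N(3)] by simp
          ultimately show "\<exists>w\<in>?V. z = w \<otimes>\<^bsub>M\<^esub> T [b]" using w by auto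
        qed
      qed
      \<comment> \<open>The induction hypothesis with \<open>b\<close> moved from \<open>N\<close>
        to \<open>X\<close>; its side condition holds because only letters independent of
        \<open>b\<close> are kept.\<close>
      also have "(\<Sum>z\<in>?Z. f z * clique_poly \<phi> (L \<inter> Ib \<inter> A z)) =
          (\<Sum>w | w \<in> bounded_traces K \<and> insert b X \<subseteq> last_letters w \<and> last_letters w \<inter> (L \<inter> Ib) = {}. f w)"
        unfolding A_def
      proof (rule less.hyps[OF card(2)])
        show "\<forall>a\<in>L \<inter> Ib. \<forall>x\<in>insert b X. (a, x) \<in> I"
          using less.prems(3) by (auto simp: L_def Ib_def)
      qed (use less.prems in \<open>auto simp: L_def\<close>)
      also have "{w. w \<in> bounded_traces K \<and> insert b X \<subseteq> last_letters w \<and> last_letters w \<inter> (L \<inter> Ib) = {}} =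
          {w. w \<in> bounded_traces K \<and> X \<subseteq> last_letters w \<and> last_letters w \<inter> L = {} \<and> b \<in> last_letters w}"
      proof -
        have "last_letters w \<inter> L \<subseteq> Ib" if "w \<in> bounded_traces K" "b \<in> last_letters w" for w
          using last_letters_indep[of w _ b] that bounded_traces_carrier N by (auto simp: Ib_def)
        then show ?thesis by auto
      qed
      also have "(\<Sum>w\<in>?W. f w * clique_poly \<phi> (L \<inter> A w)) =
          (\<Sum>w | w \<in> bounded_traces K \<and> X \<subseteq> last_letters w \<and> last_letters w \<inter> L = {}. f w)"
        unfolding A_def
        by (rule less.hyps[OF card(1)]) (use less.prems in \<open>auto simp: L_def\<close>)
      \<comment> \<open>Among the traces without last letter in \<open>L\<close>, those ending with
        \<open>b\<close> cancel; the others have no last letter in \<open>N\<close>.\<close>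
      also have "\<dots> - (\<Sum>w | w \<in> bounded_traces K \<and> X \<subseteq> last_letters w \<and> last_letters w \<inter> L = {} \<and> b \<in> last_letters w. f w) =
          (\<Sum>w\<in>{w. w \<in> bounded_traces K \<and> X \<subseteq> last_letters w \<and> last_letters w \<inter> L = {}} -
            {w. w \<in> bounded_traces K \<and> X \<subseteq> last_letters w \<and> last_letters w \<inter> L = {} \<and> b \<in> last_letters w}. f w)"
        by (rule sum_diff[symmetric]) (use finW in \<open>auto elim!: rev_finite_subset\<close>)
      also have "\<dots> = (\<Sum>w | w \<in> bounded_traces K \<and> X \<subseteq> last_letters w \<and> last_letters w \<inter> N = {}. f w)"
        using N by (intro sum.cong) auto
      finally show ?thesis by (simp only: A_def)
    qed
  qed
qed

lemma sum_bounded_traces_clique_poly: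
  assumes f: "valuation \<Sigma> I f"
  shows "(\<Sum>w\<in>bounded_traces K. f w * clique_poly (\<lambda>a. f (T [a])) {a \<in> \<Sigma>. letter_count w a < K a}) = 1"
proof -
  have "{w. w \<in> bounded_traces K \<and> {} \<subseteq> last_letters w \<and> last_letters w \<inter> \<Sigma> = {}} = {\<one>\<^bsub>M\<^esub>}"
  proof (rule Set.set_eqI)
    fix w
    have "last_letters w \<inter> \<Sigma> = last_letters w" by (auto simp: last_letters_def)
    then show "w \<in> {w. w \<in> bounded_traces K \<and> {} \<subseteq> last_letters w \<and> last_letters w \<inter> \<Sigma> = {}} \<longleftrightarrow> w \<in> {\<one>\<^bsub>M\<^esub>}"
      using one_bounded_traces last_letters_one last_letters_empty bounded_traces_carrier by blast
  qed
  then show ?thesis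
    using sum_bounded_traces_clique_poly_last_letters[OF f, of \<Sigma> "{}" K] valuation_one[OF f]
    by (simp add: Int_def)
qed

text \<open>Left multiplication by \<open>u\<close> is a bijection from the traces bounded by
  \<open>?K\<close>, it pulls out the factor \<open>f u\<close>, and the remaining sum is the total
  mass 1 for the bounds \<open>?K\<close>. The subtraction in \<open>?K\<close> is exact on
  \<open>\<Sigma>\<close> because \<open>u\<close> respects \<open>K\<close>.\<close>

lemma sum_bounded_traces_clique_poly_ge:
  assumes f: "valuation \<Sigma> I f" and u: "u \<in> bounded_traces K"
  shows "(\<Sum>w | w \<in> bounded_traces K \<and> u divides\<^bsub>M\<^esub> w.
      f w * clique_poly (\<lambda>a. f (T [a])) {a \<in> \<Sigma>. letter_count w a < K a}) = f u"
proof -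
  let ?K = "\<lambda>a. K a - letter_count u a" and ?p = "clique_poly (\<lambda>a. f (T [a]))"
  have uc: "u \<in> carrier M" using u bounded_traces_carrier by auto
  have le: "letter_count u a \<le> K a" if "a \<in> \<Sigma>" for a using u that by (auto simp: bounded_traces_def)
  have "bij_betw (\<lambda>w. u \<otimes>\<^bsub>M\<^esub> w) (bounded_traces ?K) {w. w \<in> bounded_traces K \<and> u divides\<^bsub>M\<^esub> w}"
  proof (rule bij_betwI')
    fix w v assume "w \<in> bounded_traces ?K" "v \<in> bounded_traces ?K"
    then show "(u \<otimes>\<^bsub>M\<^esub> w = u \<otimes>\<^bsub>M\<^esub> v) = (w = v)"
      using left_cancel[OF uc] bounded_traces_carrier by auto
  next
    fix w assume w: "w \<in> bounded_traces ?K"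
    show "u \<otimes>\<^bsub>M\<^esub> w \<in> {w. w \<in> bounded_traces K \<and> u divides\<^bsub>M\<^esub> w}"
      using w uc le by (fastforce simp: bounded_traces_def letter_count_mult)
  next
    fix z assume z: "z \<in> {w. w \<in> bounded_traces K \<and> u divides\<^bsub>M\<^esub> w}"
    then obtain w where w: "w \<in> carrier M" "z = u \<otimes>\<^bsub>M\<^esub> w" by (auto simp: factor_def)
    then have "w \<in> bounded_traces ?K" using z uc by (fastforce simp: bounded_traces_def letter_count_mult)
    then show "\<exists>w\<in>bounded_traces ?K. z = u \<otimes>\<^bsub>M\<^esub> w" using w by auto
  qed
  then have "(\<Sum>w | w \<in> bounded_traces K \<and> u divides\<^bsub>M\<^esub> w. f w * ?p {a \<in> \<Sigma>. letter_count w a < K a}) =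
      (\<Sum>w\<in>bounded_traces ?K. f (u \<otimes>\<^bsub>M\<^esub> w) * ?p {a \<in> \<Sigma>. letter_count (u \<otimes>\<^bsub>M\<^esub> w) a < K a})"
    by (rule sum.reindex_bij_betw[symmetric])
  also have "\<dots> = (\<Sum>w\<in>bounded_traces ?K. f u * (f w * ?p {a \<in> \<Sigma>. letter_count w a < ?K a}))"
  proof (rule sum.cong[OF HOL.refl])
    fix w assume "w \<in> bounded_traces ?K"
    then have w: "w \<in> carrier M" using bounded_traces_carrier by auto
    have "{a \<in> \<Sigma>. letter_count (u \<otimes>\<^bsub>M\<^esub> w) a < K a} = {a \<in> \<Sigma>. letter_count w a < ?K a}"
      using le uc w by (auto simp: letter_count_mult)
    then show "f (u \<otimes>\<^bsub>M\<^esub> w) * ?p {a \<in> \<Sigma>. letter_count (u \<otimes>\<^bsub>M\<^esub> w) a < K a} =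
        f u * (f w * ?p {a \<in> \<Sigma>. letter_count w a < ?K a})"
      using valuation_mult[OF f uc w] by simp
  qed
  also have "\<dots> = f u" using sum_bounded_traces_clique_poly[OF f, of ?K] by (simp add: sum_distrib_left[symmetric])
  finally show ?thesis .
qed

end

section \<open>Cliques and the Moebius transform\<close>

context independence_pair
begin

text \<open>Any enumeration of a clique \<open>d\<close> gives the same trace, see
  \<open>clique_trace_eq\<close>.\<close>

definition clique_trace :: "'a set \<Rightarrow> 'a list set" where
  "clique_trace d = T (SOME xs. set xs = d \<and> distinct xs)"

text \<open>A clique contains at most one of two distinct dependent letters, and \<open>xs\<close>
  has no repetitions.\<close>

lemma clique_set_proj:
  assumes "clique_set d" "set xs \<subseteq> d" "distinct xs" "(a, b) \<in> D"
  shows "proj a b xs = (if a \<in> set xs then [a] else if b \<in> set xs then [b] else [])"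
  using assms(2,3)
proof (induction xs)
  case (Cons x xs)
  have "\<not> (x = a \<and> b \<in> set xs)" "\<not> (x = b \<and> a \<in> set xs)"
    using Cons.prems assms(1,4) D_sym[of a b] unfolding clique_set_def D_def by auto
  then show ?case using Cons by (auto simp: proj_eq_Nil_iff)
qed auto

lemma clique_set_T_divides:
  assumes "clique_set (set xs)" "clique_set (set ys)" "distinct xs" "distinct ys"
  shows "T xs divides\<^bsub>M\<^esub> T ys \<longleftrightarrow> set xs \<subseteq> set ys"
proof -
  have l: "xs \<in> lists \<Sigma>" "ys \<in> lists \<Sigma>" using assms by (auto simp: clique_set_def in_lists_conv_set)
  have "proj_le xs ys" if sub: "set xs \<subseteq> set ys"
    unfolding proj_le_def
  proof clarify
    fix a b assume ab: "(a, b) \<in> D"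
    have "a = b \<or> \<not> (a \<in> set ys \<and> b \<in> set ys)" using ab assms(2) by (auto simp: clique_set_def D_def)
    then show "prefix (proj a b xs) (proj a b ys)"
      using sub clique_set_proj[OF assms(1) _ assms(3) ab] clique_set_proj[OF assms(2) _ assms(4) ab] by auto
  qed
  moreover have "set xs \<subseteq> set ys" if "proj_le xs ys"
  proof
    fix a assume a: "a \<in> set xs"
    then have "(a, a) \<in> D" using l D_refl by (auto simp: in_lists_conv_set)
    from proj_le_D[OF that this] have "set (proj a a xs) \<subseteq> set (proj a a ys)" by (rule set_mono_prefix)
    then show "a \<in> set ys" using a by (auto simp: set_proj)
  qed
  ultimately show ?thesis using l divides_iff by blast
qed

lemma clique_trace_word:
  assumes "clique_set d" obtains xs where "set xs = d" "distinct xs" "xs \<in> lists \<Sigma>" "clique_trace d = T xs"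
proof -
  have "\<exists>xs. set xs = d \<and> distinct xs" using finite_distinct_list[OF clique_set_finite[OF assms]] by blast
  from someI_ex[OF this] show thesis
    using assms that by (auto simp: clique_trace_def clique_set_def in_lists_conv_set)
qed

lemma clique_trace_carrier [simp]: "clique_set d \<Longrightarrow> clique_trace d \<in> carrier M"
  by (metis clique_trace_word T_carrier)

lemma clique_trace_divides: "clique_set c \<Longrightarrow> clique_set d \<Longrightarrow> clique_trace c divides\<^bsub>M\<^esub> clique_trace d \<longleftrightarrow> c \<subseteq> d"
  by (metis clique_trace_word clique_set_T_divides)

lemma clique_trace_inj: "clique_set c \<Longrightarrow> clique_set d \<Longrightarrow> clique_trace c = clique_trace d \<Longrightarrow> c = d"
  by (metis clique_trace_divides clique_trace_carrier M_divides_refl subset_antisym)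

lemma clique_trace_eq:
  assumes "clique_set (set xs)" "distinct xs" shows "clique_trace (set xs) = T xs"
proof -
  obtain ys where ys: "set ys = set xs" "distinct ys" "ys \<in> lists \<Sigma>" "clique_trace (set xs) = T ys"
    using clique_trace_word[OF assms(1)] by blast
  have "xs \<in> lists \<Sigma>" using assms by (auto simp: clique_set_def in_lists_conv_set)
  then show ?thesis
    using clique_set_T_divides[of xs ys] clique_set_T_divides[of ys xs] assms ys divides_antisym[of "T xs" "T ys"] by simp
qed

lemma clique_set_empty [simp]: "clique_set {}"
  by (simp add: clique_set_def)

lemma clique_trace_empty: "clique_trace {} = \<one>\<^bsub>M\<^esub>"
  using clique_trace_eq[of "[]"] by (simp add: one_M)

lemma trace_length_clique_trace: "clique_set d \<Longrightarrow> trace_length (clique_trace d) = card d"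
  by (metis clique_trace_word trace_length_T distinct_card)

lemma trace_cliques_eq: "trace_cliques \<Sigma> I = clique_trace ` {d. clique_set d}"
proof (intro equalityI subsetI)
  fix c assume "c \<in> trace_cliques \<Sigma> I"
  then obtain w where w: "c = T w" "w \<in> lists \<Sigma>"
    "\<And>i j. i < length w \<Longrightarrow> j < length w \<Longrightarrow> i \<noteq> j \<Longrightarrow> (w ! i, w ! j) \<in> I"
    by (auto simp: trace_cliques_def)
  \<comment> \<open>A repeated letter would be independent of itself.\<close>
  have "distinct w" unfolding distinct_conv_nth using w(3) I_neq by metis
  moreover have "clique_set (set w)"
    using w by (auto simp: clique_set_def in_lists_conv_set in_set_conv_nth) metis
  ultimately show "c \<in> clique_trace ` {d. clique_set d}" using clique_trace_eq w by auto
next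
  fix c assume "c \<in> clique_trace ` {d. clique_set d}"
  then obtain d where d: "clique_set d" "c = clique_trace d" by auto
  then obtain xs where xs: "set xs = d" "distinct xs" "xs \<in> lists \<Sigma>" "c = T xs"
    using clique_trace_word by metis
  have "(xs ! i, xs ! j) \<in> I" if "i < length xs" "j < length xs" "i \<noteq> j" for i j
    using that d xs(1,2) nth_eq_iff_index_eq[of xs i j] unfolding clique_set_def by auto
  then show "c \<in> trace_cliques \<Sigma> I" using xs by (auto simp: trace_cliques_def)
qed

section \<open>The Moebius transform in terms of the clique polynomial\<close>

lemma valuation_T:
  assumes "valuation \<Sigma> I f" "w \<in> lists \<Sigma>"
  shows "f (T w) = (\<Prod>a\<leftarrow>w. f (T [a]))"
  using assms(2)
proof (induction w rule: list.induct)
  case Nil then show ?case using valuation_one[OF assms(1)] by (simp add: one_M)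
next
  case (Cons a w)
  then show ?case
    using valuation_mult[OF assms(1), of "T [a]" "T w"] by (simp add: mult_T)
qed

lemma valuation_clique_trace:
  assumes "valuation \<Sigma> I f" "clique_set d" shows "f (clique_trace d) = (\<Prod>a\<in>d. f (T [a]))"
proof -
  obtain xs where "set xs = d" "distinct xs" "xs \<in> lists \<Sigma>" "clique_trace d = T xs"
    using clique_trace_word[OF assms(2)] by blast
  then show ?thesis
    using valuation_T[OF assms(1)] prod.distinct_set_conv_list[of xs "\<lambda>a. f (T [a])"] by simp
qed

lemma moebius_clique_trace_sum:
  assumes f: "valuation \<Sigma> I f" and c: "clique_set c"
  shows "moebius_transform \<Sigma> I f (clique_trace c) =
    (\<Sum>d | clique_set d \<and> c \<subseteq> d. (- 1) ^ (card d - card c) * (\<Prod>a\<in>d. f (T [a])))"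
proof -
  have eq: "{c'. c' \<in> trace_cliques \<Sigma> I \<and> clique_trace c divides\<^bsub>M\<^esub> c'} = clique_trace ` {d. clique_set d \<and> c \<subseteq> d}"
    using c by (auto simp: trace_cliques_eq clique_trace_divides)
  have inj: "inj_on clique_trace {d. clique_set d \<and> c \<subseteq> d}" using clique_trace_inj by (auto intro!: inj_onI)
  show ?thesis
    unfolding moebius_transform_def eq sum.reindex[OF inj]
    by (intro sum.cong) (auto simp: trace_length_clique_trace c valuation_clique_trace[OF f])
qed

text \<open>The cliques above \<open>c\<close> are the disjoint unions of \<open>c\<close> with a
  clique of letters independent of all of \<open>c\<close>; multiplicativity of \<open>f\<close>
  pulls out the factor of \<open>c\<close>.\<close>

lemma moebius_clique_trace:
  assumes f: "valuation \<Sigma> I f" and c: "clique_set c"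
  defines "\<phi> \<equiv> \<lambda>a. f (T [a])"
  shows "moebius_transform \<Sigma> I f (clique_trace c) =
    f (clique_trace c) * clique_poly \<phi> {a \<in> \<Sigma>. \<forall>x\<in>c. (a, x) \<in> I}"
proof -
  let ?N = "{a \<in> \<Sigma>. \<forall>x\<in>c. (a, x) \<in> I}"
  have disj: "c \<inter> e = {}" if "e \<subseteq> ?N" for e using that I_neq by auto
  have "bij_betw (\<lambda>e. c \<union> e) {e. clique_set e \<and> e \<subseteq> ?N} {d. clique_set d \<and> c \<subseteq> d}"
  proof (rule bij_betwI[where g = "\<lambda>d. d - c"])
    have "clique_set (c \<union> e)" if "clique_set e" "e \<subseteq> ?N" for e
    proof -
      have "(a, b) \<in> I \<and> (b, a) \<in> I" if "a \<in> c" "b \<in> e" for a b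
        using that \<open>e \<subseteq> ?N\<close> I_sym[of a b] by auto
      then show ?thesis using \<open>clique_set e\<close> c by (auto simp: clique_set_def)
    qed
    then show "(\<lambda>e. c \<union> e) \<in> {e. clique_set e \<and> e \<subseteq> ?N} \<rightarrow> {d. clique_set d \<and> c \<subseteq> d}" by auto
    show "(\<lambda>d. d - c) \<in> {d. clique_set d \<and> c \<subseteq> d} \<rightarrow> {e. clique_set e \<and> e \<subseteq> ?N}"
    proof (intro Pi_I CollectI conjI subsetI; elim CollectE conjE)
      fix d assume d: "clique_set d" "c \<subseteq> d"
      then show "clique_set (d - c)" by (auto simp: clique_set_def)
      fix a assume "a \<in> d - c"
      then show "a \<in> \<Sigma>" "\<forall>x\<in>c. (a, x) \<in> I" using d unfolding clique_set_def by (blast, fast)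
    qed
    show "c \<union> e - c = e" if "e \<in> {e. clique_set e \<and> e \<subseteq> ?N}" for e using that disj[of e] by auto
    show "c \<union> (d - c) = d" if "d \<in> {d. clique_set d \<and> c \<subseteq> d}" for d using that by auto
  qed
  then have "moebius_transform \<Sigma> I f (clique_trace c) =
      (\<Sum>e | clique_set e \<and> e \<subseteq> ?N. (- 1) ^ (card (c \<union> e) - card c) * (\<Prod>a\<in>c \<union> e. \<phi> a))"
    unfolding moebius_clique_trace_sum[OF f c] \<phi>_def by (rule sum.reindex_bij_betw[symmetric])
  also have "\<dots> = (\<Sum>e | clique_set e \<and> e \<subseteq> ?N. f (clique_trace c) * (\<Prod>a\<in>e. - \<phi> a))"
  proof (rule sum.cong[OF HOL.refl])
    fix e assume e: "e \<in> {e. clique_set e \<and> e \<subseteq> ?N}"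
    then have fin: "finite e" "finite c" "c \<inter> e = {}" using clique_set_finite c disj by auto
    then show "(- 1) ^ (card (c \<union> e) - card c) * (\<Prod>a\<in>c \<union> e. \<phi> a) = f (clique_trace c) * (\<Prod>a\<in>e. - \<phi> a)"
      by (simp add: card_Un_disjoint prod.union_disjoint valuation_clique_trace[OF f c] prod_uminus \<phi>_def)
  qed
  finally show ?thesis by (simp add: clique_poly_def sum_distrib_left)
qed

lemma moebius_one:
  assumes "valuation \<Sigma> I f"
  shows "moebius_transform \<Sigma> I f \<one>\<^bsub>M\<^esub> = clique_poly (\<lambda>a. f (T [a])) \<Sigma>"
  using moebius_clique_trace[OF assms clique_set_empty] valuation_one[OF assms] by (simp add: clique_trace_empty)

text \<open>Expansion of the product of \<open>1 - 1\<close> over \<open>S\<close>.\<close>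

lemma sum_Pow_neg_one:
  assumes "finite S"
  shows "(\<Sum>X\<in>Pow S. (- 1) ^ card X) = (if S = {} then 1 else (0::real))"
  using prod_diff_conv_sum[OF assms, of "\<lambda>_. 1::real" "\<lambda>_. 1"] assms
  by (auto simp: card_gt_0_iff power_0_left)

text \<open>Moebius inversion: after exchanging the sums, a clique \<open>d\<close> receives the
  alternating sum over the subsets of \<open>d - N\<close>, which vanishes unless
  \<open>d \<subseteq> N\<close>.\<close>

lemma clique_poly_moebius:
  assumes f: "valuation \<Sigma> I f"
  shows "clique_poly (\<lambda>a. f (T [a])) N =
    (\<Sum>c | clique_set c \<and> c \<inter> N = {}. moebius_transform \<Sigma> I f (clique_trace c))"
proof -
  define \<phi> where "\<phi> = (\<lambda>a. f (T [a]))"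
  have "(\<Sum>c | clique_set c \<and> c \<inter> N = {}. moebius_transform \<Sigma> I f (clique_trace c)) =
      (\<Sum>c | clique_set c \<and> c \<inter> N = {}.
        \<Sum>d | d \<in> {d. clique_set d} \<and> c \<subseteq> d. (- 1) ^ (card d - card c) * (\<Prod>a\<in>d. \<phi> a))"
    by (intro sum.cong) (auto simp: moebius_clique_trace_sum[OF f] \<phi>_def)
  also have "\<dots> = (\<Sum>d | clique_set d. \<Sum>c | c \<in> {c. clique_set c \<and> c \<inter> N = {}} \<and> c \<subseteq> d.
      (- 1) ^ (card d - card c) * (\<Prod>a\<in>d. \<phi> a))"
    using finite_clique_set[of "\<lambda>_. True"] by (intro sum.swap_restrict finite_clique_set) auto
  also have "\<dots> = (\<Sum>d | clique_set d. if d \<subseteq> N then (\<Prod>a\<in>d. - \<phi> a) else 0)"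
  proof (rule sum.cong[OF HOL.refl])
    fix d assume "d \<in> {d. clique_set d}"
    then have d: "clique_set d" "finite d" using clique_set_finite by auto
    have "{c. c \<in> {c. clique_set c \<and> c \<inter> N = {}} \<and> c \<subseteq> d} = Pow (d - N)"
      using d by (auto simp: clique_set_def)
    then have "(\<Sum>c | c \<in> {c. clique_set c \<and> c \<inter> N = {}} \<and> c \<subseteq> d.
          (- 1) ^ (card d - card c) * (\<Prod>a\<in>d. \<phi> a)) =
        (\<Sum>c\<in>Pow (d - N). ((- 1) ^ card d * (\<Prod>a\<in>d. \<phi> a)) * (- 1) ^ card c)"
    proof (simp only:, intro sum.cong[OF HOL.refl])
      fix c assume "c \<in> Pow (d - N)"
      then have "card c \<le> card d" using d by (intro card_mono) auto
      then obtain k where k: "card d = card c + k" using le_Suc_ex by blast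
      have "(- 1) ^ card c * ((- 1) ^ card c * (- 1) ^ k) = (- 1 :: real) ^ k"
        by (rule left_minus_one_mult_self)
      then have "(- 1 :: real) ^ (card d - card c) = (- 1) ^ card d * (- 1) ^ card c"
        unfolding k power_add diff_add_inverse by (simp only: mult_ac)
      then show "(- 1) ^ (card d - card c) * (\<Prod>a\<in>d. \<phi> a) =
          ((- 1) ^ card d * (\<Prod>a\<in>d. \<phi> a)) * (- 1) ^ card c" by simp
    qed
    also have "\<dots> = (if d \<subseteq> N then (\<Prod>a\<in>d. - \<phi> a) else 0)"
      using d by (auto simp: sum_distrib_left[symmetric] sum_Pow_neg_one prod_uminus)
    finally show "(\<Sum>c | c \<in> {c. clique_set c \<and> c \<inter> N = {}} \<and> c \<subseteq> d.
          (- 1) ^ (card d - card c) * (\<Prod>a\<in>d. \<phi> a)) =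
        (if d \<subseteq> N then (\<Prod>a\<in>d. - \<phi> a) else 0)" .
  qed
  also have "\<dots> = clique_poly \<phi> N"
    unfolding clique_poly_def using finite_clique_set[of "\<lambda>_. True"]
    by (subst sum.inter_filter[symmetric]) auto
  finally show ?thesis by (simp add: \<phi>_def)
qed

text \<open>All terms of the preceding sum are non-negative: the one of the unit is zero, the others
  are positive. This makes the weights on bounded traces non-negative.\<close>

lemma clique_poly_nonneg:
  assumes f: "moebius_valuation \<Sigma> I f"
  shows "clique_poly (\<lambda>a. f (T [a])) N \<ge> 0"
proof -
  have v: "valuation \<Sigma> I f" using f by (simp add: moebius_valuation_def)
  have "moebius_transform \<Sigma> I f (clique_trace c) \<ge> 0" if "clique_set c" for c
    using f that unfolding moebius_valuation_def trace_cliques_eq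
    by (cases "clique_trace c = \<one>\<^bsub>M\<^esub>") (auto intro: less_imp_le)
  then show ?thesis unfolding clique_poly_moebius[OF v] by (intro sum_nonneg) auto
qed

end

section \<open>Cylinders of the boundary\<close>

context independence_pair
begin

definition seq_class :: "(nat \<Rightarrow> 'a list set) \<Rightarrow> (nat \<Rightarrow> 'a list set) set" where
  "seq_class s = trace_seq_rel \<Sigma> I `` {s}"

lemma seqs_carrier: "s \<in> trace_seqs \<Sigma> I \<Longrightarrow> s k \<in> carrier M"
  by (auto simp: trace_seqs_def)

lemma seqs_mono: "s \<in> trace_seqs \<Sigma> I \<Longrightarrow> k \<le> l \<Longrightarrow> s k divides\<^bsub>M\<^esub> s l"
  by (auto simp: trace_seqs_def monotone_def)

lemma seqs_const: "u \<in> carrier M \<Longrightarrow> (\<lambda>_. u) \<in> trace_seqs \<Sigma> I"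
  by (auto simp: trace_seqs_def monotone_def M_divides_refl)

lemma seq_le_refl: "s \<in> trace_seqs \<Sigma> I \<Longrightarrow> trace_seq_le \<Sigma> I s s"
  using M_divides_refl seqs_carrier unfolding trace_seq_le_def by blast

lemma seq_le_trans:
  assumes "s \<in> trace_seqs \<Sigma> I" "trace_seq_le \<Sigma> I s t" "trace_seq_le \<Sigma> I t r"
  shows "trace_seq_le \<Sigma> I s r"
  using assms M_divides_trans seqs_carrier unfolding trace_seq_le_def by meson

lemma equiv_seq_rel: "equiv (trace_seqs \<Sigma> I) (trace_seq_rel \<Sigma> I)"
proof (rule equivI)
  show "trans (trace_seq_rel \<Sigma> I)"
    using seq_le_trans unfolding trans_def trace_seq_rel_def by blast
qed (auto simp: trace_seq_rel_def refl_on_def sym_def seq_le_refl)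

lemma seq_class_eq_iff:
  assumes "s \<in> trace_seqs \<Sigma> I" "t \<in> trace_seqs \<Sigma> I"
  shows "seq_class s = seq_class t \<longleftrightarrow> trace_seq_le \<Sigma> I s t \<and> trace_seq_le \<Sigma> I t s"
  unfolding seq_class_def using eq_equiv_class_iff[OF equiv_seq_rel assms] assms
  by (simp add: trace_seq_rel_def)

text \<open>Equivalence with the constant sequence \<open>x\<close> means that the sequence stays
  below \<open>x\<close> and reaches it.\<close>

lemma seq_class_in_boundary:
  assumes "s \<in> trace_seqs \<Sigma> I"
  shows "seq_class s \<in> boundary \<Sigma> I \<longleftrightarrow> (\<forall>x\<in>carrier M. \<not> ((\<forall>k. s k divides\<^bsub>M\<^esub> x) \<and> (\<exists>k. x divides\<^bsub>M\<^esub> s k)))"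
proof -
  have "seq_class s \<in> gen_traces \<Sigma> I" using assms by (auto simp: gen_traces_def seq_class_def quotientI)
  then have "seq_class s \<in> boundary \<Sigma> I \<longleftrightarrow> (\<forall>x\<in>carrier M. seq_class s \<noteq> trace_embed \<Sigma> I x)"
    by (auto simp: boundary_def)
  moreover have "seq_class s = trace_embed \<Sigma> I x \<longleftrightarrow> (\<forall>k. s k divides\<^bsub>M\<^esub> x) \<and> (\<exists>k. x divides\<^bsub>M\<^esub> s k)"
    if "x \<in> carrier M" for x
    using seq_class_eq_iff[OF assms seqs_const[OF that]]
    by (simp add: trace_embed_def seq_class_def trace_seq_le_def)
  ultimately show ?thesis by (simp cong: ball_cong)
qed

lemma boundaryE:
  assumes "\<xi> \<in> boundary \<Sigma> I" obtains s where "s \<in> trace_seqs \<Sigma> I" "\<xi> = seq_class s"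
  using assms by (auto simp: boundary_def gen_traces_def seq_class_def quotient_def)

text \<open>The order on classes asks for some pair of representatives; by transitivity the constant
  sequence \<open>u\<close> and the given \<open>s\<close> will do.\<close>

lemma in_cylinder:
  assumes s: "s \<in> trace_seqs \<Sigma> I" and u: "u \<in> carrier M"
  shows "seq_class s \<in> cylinder \<Sigma> I u \<longleftrightarrow> seq_class s \<in> boundary \<Sigma> I \<and> (\<exists>k. u divides\<^bsub>M\<^esub> s k)"
proof -
  have "gen_trace_le \<Sigma> I (trace_embed \<Sigma> I u) (seq_class s) \<longleftrightarrow> trace_seq_le \<Sigma> I (\<lambda>_. u) s"
  proof
    assume "gen_trace_le \<Sigma> I (trace_embed \<Sigma> I u) (seq_class s)"
    then obtain r t where r: "r \<in> trace_seqs \<Sigma> I" "trace_seq_le \<Sigma> I (\<lambda>_. u) r" "trace_seq_le \<Sigma> I r t"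
      "trace_seq_le \<Sigma> I t s"
      by (auto simp: gen_trace_le_def trace_embed_def seq_class_def trace_seq_rel_def)
    have "trace_seq_le \<Sigma> I (\<lambda>_. u) t" using seq_le_trans[OF seqs_const[OF u] r(2,3)] .
    from seq_le_trans[OF seqs_const[OF u] this r(4)] show "trace_seq_le \<Sigma> I (\<lambda>_. u) s" .
  next
    assume "trace_seq_le \<Sigma> I (\<lambda>_. u) s"
    moreover have "(\<lambda>_. u) \<in> trace_embed \<Sigma> I u"
      using seqs_const[OF u] seq_le_refl by (auto simp: trace_embed_def trace_seq_rel_def)
    moreover have "s \<in> seq_class s" using s seq_le_refl by (auto simp: seq_class_def trace_seq_rel_def)
    ultimately show "gen_trace_le \<Sigma> I (trace_embed \<Sigma> I u) (seq_class s)"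
      by (auto simp: gen_trace_le_def)
  qed
  then show ?thesis by (simp add: cylinder_def trace_seq_le_def)
qed

section \<open>Monotonicity and intersections of cylinders\<close>

lemma cylinder_boundary: "cylinder \<Sigma> I u \<subseteq> boundary \<Sigma> I"
  by (auto simp: cylinder_def)

lemma cylinder_one: "cylinder \<Sigma> I \<one>\<^bsub>M\<^esub> = boundary \<Sigma> I"
proof
  show "boundary \<Sigma> I \<subseteq> cylinder \<Sigma> I \<one>\<^bsub>M\<^esub>"
  proof
    fix \<xi> assume x: "\<xi> \<in> boundary \<Sigma> I"
    then obtain s where s: "s \<in> trace_seqs \<Sigma> I" "\<xi> = seq_class s" using boundaryE by metis
    then show "\<xi> \<in> cylinder \<Sigma> I \<one>\<^bsub>M\<^esub>"
      using x in_cylinder one_divides seqs_carrier M_one_closed by blast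
  qed
qed (rule cylinder_boundary)

lemma cylinder_mono:
  assumes "u \<in> carrier M" "v \<in> carrier M" "u divides\<^bsub>M\<^esub> v"
  shows "cylinder \<Sigma> I v \<subseteq> cylinder \<Sigma> I u"
proof
  fix \<xi> assume x: "\<xi> \<in> cylinder \<Sigma> I v"
  then obtain s where s: "s \<in> trace_seqs \<Sigma> I" "\<xi> = seq_class s"
    using boundaryE cylinder_boundary by (metis subsetD)
  then show "\<xi> \<in> cylinder \<Sigma> I u"
    using x in_cylinder[OF s(1)] assms M_divides_trans by blast
qed

text \<open>A sufficiently late term of a sequence representing \<open>\<xi>\<close> serves as
  \<open>x\<close>.\<close>

lemma cylinder_directed:
  assumes "u \<in> carrier M" "v \<in> carrier M" "\<xi> \<in> cylinder \<Sigma> I u" "\<xi> \<in> cylinder \<Sigma> I v"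
  shows "\<exists>x\<in>carrier M. u divides\<^bsub>M\<^esub> x \<and> v divides\<^bsub>M\<^esub> x \<and> \<xi> \<in> cylinder \<Sigma> I x"
proof -
  obtain s where s: "s \<in> trace_seqs \<Sigma> I" "\<xi> = seq_class s"
    using assms(3) boundaryE cylinder_boundary by (metis subsetD)
  obtain k l where kl: "seq_class s \<in> boundary \<Sigma> I" "u divides\<^bsub>M\<^esub> s k" "v divides\<^bsub>M\<^esub> s l"
    using assms in_cylinder[OF s(1)] s(2) by blast
  have "u divides\<^bsub>M\<^esub> s (max k l)"
    by (rule M_divides_trans[OF kl(2) seqs_mono[OF s(1)] assms(1)]) simp
  moreover have "v divides\<^bsub>M\<^esub> s (max k l)"
    by (rule M_divides_trans[OF kl(3) seqs_mono[OF s(1)] assms(2)]) simp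
  moreover have "\<xi> \<in> cylinder \<Sigma> I (s (max k l))"
    using in_cylinder[OF s(1) seqs_carrier[OF s(1)]] M_divides_refl seqs_carrier[OF s(1)] s(2) kl(1) by blast
  ultimately show ?thesis using seqs_carrier[OF s(1)] by blast
qed

text \<open>A common point provides a common upper bound of \<open>u\<close> and \<open>v\<close>,
  hence a least one, whose cylinder is the intersection.\<close>

lemma cylinder_Int:
  assumes "u \<in> carrier M" "v \<in> carrier M" "cylinder \<Sigma> I u \<inter> cylinder \<Sigma> I v \<noteq> {}"
  shows "\<exists>w\<in>carrier M. cylinder \<Sigma> I u \<inter> cylinder \<Sigma> I v = cylinder \<Sigma> I w"
proof -
  obtain x where "x \<in> carrier M" "u divides\<^bsub>M\<^esub> x" "v divides\<^bsub>M\<^esub> x"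
    using assms cylinder_directed by blast
  then obtain w where w: "w \<in> carrier M"
    "\<And>x. x \<in> carrier M \<Longrightarrow> w divides\<^bsub>M\<^esub> x \<longleftrightarrow> u divides\<^bsub>M\<^esub> x \<and> v divides\<^bsub>M\<^esub> x"
    using lub_exists[OF assms(1,2)] by meson
  have "u divides\<^bsub>M\<^esub> w" "v divides\<^bsub>M\<^esub> w" using w M_divides_refl by blast+
  then have "cylinder \<Sigma> I w \<subseteq> cylinder \<Sigma> I u \<inter> cylinder \<Sigma> I v"
    using cylinder_mono assms w(1) by blast
  moreover have "\<xi> \<in> cylinder \<Sigma> I w" if \<xi>: "\<xi> \<in> cylinder \<Sigma> I u" "\<xi> \<in> cylinder \<Sigma> I v" for \<xi>
  proof -
    obtain y where y: "y \<in> carrier M" "u divides\<^bsub>M\<^esub> y" "v divides\<^bsub>M\<^esub> y" "\<xi> \<in> cylinder \<Sigma> I y"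
      using cylinder_directed[OF assms(1,2) \<xi>] by blast
    then have "w divides\<^bsub>M\<^esub> y" using w(2) by blast
    then show ?thesis using cylinder_mono[OF w(1) y(1)] y(4) by blast
  qed
  ultimately show ?thesis using w(1) by blast
qed

text \<open>A sequence that is constantly the unit represents a finite trace, so some term has a
  first letter.\<close>

lemma boundary_letter:
  assumes "\<xi> \<in> boundary \<Sigma> I" shows "\<exists>a\<in>\<Sigma>. \<xi> \<in> cylinder \<Sigma> I (T [a])"
proof -
  obtain s where s: "s \<in> trace_seqs \<Sigma> I" "\<xi> = seq_class s" using assms boundaryE by metis
  have "\<exists>k. s k \<noteq> \<one>\<^bsub>M\<^esub>"
  proof (rule ccontr)
    assume "\<not> ?thesis"
    then have "s k = \<one>\<^bsub>M\<^esub>" for k by blast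
    then show False
      using assms seq_class_in_boundary[OF s(1)] s(2) M_one_closed M_divides_refl[OF M_one_closed] by metis
  qed
  then obtain k where k: "s k \<noteq> \<one>\<^bsub>M\<^esub>" by blast
  obtain w where w: "w \<in> lists \<Sigma>" "s k = T w" using seqs_carrier[OF s(1)] carrierE by metis
  then obtain a w' where aw: "w = a # w'" using k by (cases w) (auto simp: one_M)
  then have "a \<in> \<Sigma>" "T w = T [a] \<otimes>\<^bsub>M\<^esub> T w'" "w' \<in> lists \<Sigma>" using w by (auto simp: mult_T)
  then have "a \<in> \<Sigma>" "T [a] divides\<^bsub>M\<^esub> s k" using w by simp_all
  then show ?thesis using in_cylinder[OF s(1)] assms s(2) T_single by blast
qed

section \<open>Inclusion-exclusion over cylinders\<close>

text \<open>Inclusion-exclusion, organised along \<open>clique_poly_insert\<close>. The family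
  \<open>E\<close> is abstract because it is used twice: for cylinders of the boundary, and for the
  sets of traces divisible by \<open>u\<close> under a distribution on bounded traces, where the
  values are known only within the bounds \<open>K\<close>.\<close>

lemma measure_minus_clique_poly:
  assumes f: "valuation \<Sigma> I f" and "finite_measure P"
    and E: "\<And>u. u \<in> carrier M \<Longrightarrow> E u \<in> sets P"
    and mono: "\<And>u v. u \<in> carrier M \<Longrightarrow> v \<in> carrier M \<Longrightarrow> u divides\<^bsub>M\<^esub> v \<Longrightarrow> E v \<subseteq> E u"
    and dir: "\<And>u v \<omega>. u \<in> carrier M \<Longrightarrow> v \<in> carrier M \<Longrightarrow> \<omega> \<in> E u \<Longrightarrow> \<omega> \<in> E v \<Longrightarrow>
      \<exists>x\<in>carrier M. u divides\<^bsub>M\<^esub> x \<and> v divides\<^bsub>M\<^esub> x \<and> \<omega> \<in> E x"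
    and val: "\<And>u. u \<in> bounded_traces K \<Longrightarrow> measure P (E u) = f u"
    and v: "v \<in> bounded_traces K" and N: "N \<subseteq> {a \<in> \<Sigma>. letter_count v a < K a}"
  shows "measure P (E v - (\<Union>a\<in>N. E (v \<otimes>\<^bsub>M\<^esub> T [a]))) = f v * clique_poly (\<lambda>a. f (T [a])) N"
proof -
  interpret finite_measure P by fact
  have "finite N" using N finite_letters finite_subset[of N \<Sigma>] by blast
  then show ?thesis using v N
  proof (induction "card N" arbitrary: N v rule: less_induct)
    case less
    show ?case
    proof (cases "N = {}")
      case True then show ?thesis using val less.prems by simp
    next
      case False
      then obtain b where b: "b \<in> N" by auto
      define L where "L = N - {b}"
      define J where "J = L \<inter> {a. (a, b) \<in> I}"
      define w where "w = v \<otimes>\<^bsub>M\<^esub> T [b]"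
      have bS: "b \<in> \<Sigma>" "letter_count v b < K b" and NL: "N = insert b L" "b \<notin> L" "L \<subseteq> \<Sigma>"
        using b less.prems by (auto simp: L_def)
      have card: "card L < card N" "card J < card N"
        using b less.prems(1) unfolding L_def J_def by (blast intro!: psubset_card_mono)+
      have fin: "finite L" "finite J" using less.prems(1) by (auto simp: L_def J_def)
      have vc: "v \<in> carrier M" and wc: "w \<in> carrier M"
        using less.prems bounded_traces_carrier bS by (auto simp: w_def)
      \<comment> \<open>Appending \<open>b\<close> respects its bound and leaves the counts of the
        letters in \<open>L\<close> unchanged, so the induction hypothesis applies to
        \<open>w\<close> and \<open>J\<close>.\<close>
      have wb: "w \<in> bounded_traces K" using less.prems(2) bS vc by (auto simp: bounded_traces_def w_def letter_count_mult letter_count_T)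
      have cw: "letter_count w a = letter_count v a" if "a \<in> L" for a
        using that NL bS vc by (auto simp: w_def letter_count_mult letter_count_T)
      \<comment> \<open>A point above both \<open>v\<close> followed by \<open>a\<close> and
        \<open>v\<close> followed by \<open>b\<close> forces \<open>a\<close> and \<open>b\<close>
        to be independent and lies above \<open>w\<close> followed by \<open>a\<close>. Conversely
        independent letters commute.\<close>
      have eq: "E w \<inter> (\<Union>a\<in>L. E (v \<otimes>\<^bsub>M\<^esub> T [a])) = E w \<inter> (\<Union>a\<in>J. E (w \<otimes>\<^bsub>M\<^esub> T [a]))"
      proof (intro equalityI subsetI)
        fix \<omega> assume "\<omega> \<in> E w \<inter> (\<Union>a\<in>L. E (v \<otimes>\<^bsub>M\<^esub> T [a]))"
        then obtain a where a: "a \<in> L" "\<omega> \<in> E (v \<otimes>\<^bsub>M\<^esub> T [a])" and w: "\<omega> \<in> E w" by blast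
        have aS: "a \<in> \<Sigma>" "a \<noteq> b" using a NL by auto
        have ac: "v \<otimes>\<^bsub>M\<^esub> T [a] \<in> carrier M" using aS vc by simp
        obtain x where x: "x \<in> carrier M" "v \<otimes>\<^bsub>M\<^esub> T [a] divides\<^bsub>M\<^esub> x" "w divides\<^bsub>M\<^esub> x" "\<omega> \<in> E x"
          using dir[OF ac wc a(2) w] by blast
        have "(a, b) \<in> I" "w \<otimes>\<^bsub>M\<^esub> T [a] divides\<^bsub>M\<^esub> x"
          using exchange_letters[OF vc x(1) aS(1) bS(1) aS(2) x(2)] x(3) by (simp_all add: w_def)
        moreover from this(2) have "\<omega> \<in> E (w \<otimes>\<^bsub>M\<^esub> T [a])"
          using mono[of "w \<otimes>\<^bsub>M\<^esub> T [a]" x] wc aS x by auto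
        ultimately show "\<omega> \<in> E w \<inter> (\<Union>a\<in>J. E (w \<otimes>\<^bsub>M\<^esub> T [a]))" using a w by (auto simp: J_def)
      next
        fix \<omega> assume "\<omega> \<in> E w \<inter> (\<Union>a\<in>J. E (w \<otimes>\<^bsub>M\<^esub> T [a]))"
        then obtain a where a: "a \<in> L" "(a, b) \<in> I" "\<omega> \<in> E (w \<otimes>\<^bsub>M\<^esub> T [a])" and w: "\<omega> \<in> E w"
          by (auto simp: J_def)
        have aS: "a \<in> \<Sigma>" using a NL by auto
        have "trace_eq [b, a] [a, b]" using a(2) I_sym[of a b] by (auto intro: trace_cong.comm)
        then have "T [b] \<otimes>\<^bsub>M\<^esub> T [a] = T [a] \<otimes>\<^bsub>M\<^esub> T [b]"
          using aS bS by (simp add: mult_T T_eq_iff cong_iff)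
        then have "w \<otimes>\<^bsub>M\<^esub> T [a] = (v \<otimes>\<^bsub>M\<^esub> T [a]) \<otimes>\<^bsub>M\<^esub> T [b]"
          using vc aS bS by (simp add: w_def M_assoc)
        then have "E (w \<otimes>\<^bsub>M\<^esub> T [a]) \<subseteq> E (v \<otimes>\<^bsub>M\<^esub> T [a])"
          using mono[of "v \<otimes>\<^bsub>M\<^esub> T [a]" "w \<otimes>\<^bsub>M\<^esub> T [a]"] vc wc aS bS by simp
        then show "\<omega> \<in> E w \<inter> (\<Union>a\<in>L. E (v \<otimes>\<^bsub>M\<^esub> T [a]))" using a w by auto
      qed
      let ?A = "E v - (\<Union>a\<in>L. E (v \<otimes>\<^bsub>M\<^esub> T [a]))" and ?B = "E w - (\<Union>a\<in>J. E (w \<otimes>\<^bsub>M\<^esub> T [a]))"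
      have sub: "E w \<subseteq> E v" using mono[OF vc wc] vc bS by (simp add: w_def)
      have BA: "?B \<subseteq> ?A" using eq sub by blast
      \<comment> \<open>Adding \<open>b\<close> to \<open>L\<close> removes in addition the part of
        \<open>E w\<close> not removed before, which by \<open>eq\<close> is
        \<open>?B\<close>.\<close>
      have "E v - (\<Union>a\<in>N. E (v \<otimes>\<^bsub>M\<^esub> T [a])) = ?A - ?B"
        using eq NL(1) unfolding w_def by blast
      moreover have "?A \<in> sets P" "?B \<in> sets P"
        using E vc wc NL(3) fin by (auto simp: J_def intro!: sets.Diff sets.finite_UN)
      ultimately have "measure P (E v - (\<Union>a\<in>N. E (v \<otimes>\<^bsub>M\<^esub> T [a]))) = measure P ?A - measure P ?B"
        using finite_measure_Diff[OF _ _ BA] by simp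
      also have "measure P ?A = f v * clique_poly (\<lambda>a. f (T [a])) L"
        using less.prems by (intro less.hyps[OF card(1) fin(1)]) (auto simp: L_def)
      also have "measure P ?B = f w * clique_poly (\<lambda>a. f (T [a])) J"
        using less.prems wb cw by (intro less.hyps[OF card(2) fin(2)]) (auto simp: L_def J_def)
      also have "f w = f v * f (T [b])" using valuation_mult[OF f vc] bS by (simp add: w_def)
      also have "f v * clique_poly (\<lambda>a. f (T [a])) L - f v * f (T [b]) * clique_poly (\<lambda>a. f (T [a])) J =
          f v * clique_poly (\<lambda>a. f (T [a])) N"
        unfolding NL(1) J_def clique_poly_insert[OF bS(1) NL(2)] by (simp add: algebra_simps)
      finally show ?thesis .
    qed
  qed
qed

section \<open>From Bernoulli measures to Moebius valuations\<close>

lemma rtrancl_exit: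
  assumes "(x, y) \<in> R\<^sup>*" "x \<in> S" "y \<notin> S"
  shows "\<exists>p q. (p, q) \<in> R \<and> p \<in> S \<and> q \<notin> S"
  using assms by (induction rule: rtrancl_induct) blast+

text \<open>This is where irreducibility enters. Starting with the clique, letters are appended,
  each dependent on an earlier one, until all of \<open>\<Sigma>\<close> occurs. Then no letter
  \<open>a\<close> independent of the clique can directly follow it in a trace above
  \<open>u\<close>, since a dependent letter outside the clique comes before. The cylinder of
  \<open>u\<close> will make \<open>h\<close> positive.\<close>

lemma blocking_trace:
  assumes irr: "irreducible_trace_monoid \<Sigma> I" and d: "clique_set d" "d \<noteq> {}"
  shows "\<exists>u\<in>carrier M. clique_trace d divides\<^bsub>M\<^esub> u \<and>
    (\<forall>a\<in>\<Sigma>. (\<forall>y\<in>d. (a, y) \<in> I) \<longrightarrow>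
      (\<forall>x\<in>carrier M. \<not> (u divides\<^bsub>M\<^esub> x \<and> clique_trace d \<otimes>\<^bsub>M\<^esub> T [a] divides\<^bsub>M\<^esub> x)))"
proof -
  obtain xs where xs: "set xs = d" "distinct xs" "xs \<in> lists \<Sigma>" "clique_trace d = T xs"
    using clique_trace_word[OF d(1)] by blast
  \<comment> \<open>The invariant: each letter \<open>a\<close> of \<open>w\<close> outside
    \<open>d\<close> has a dependent letter \<open>b\<close> that comes before its first occurrence.
    A word with a maximal set of letters is taken.\<close>
  let ?G = "\<lambda>w. w \<in> lists \<Sigma> \<and> (\<exists>r. w = xs @ r) \<and>
    (\<forall>a\<in>set w - d. \<exists>b. (a, b) \<in> D \<and> b \<noteq> a \<and> proj a b w \<noteq> [] \<and> hd (proj a b w) = b)"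
  have "?G xs" using xs by simp
  moreover have "\<forall>w. ?G w \<longrightarrow> card (set w) < Suc (card \<Sigma>)"
    using finite_letters by (auto simp: less_Suc_eq_le in_lists_conv_set intro!: card_mono)
  ultimately obtain w where w: "?G w" and max: "\<forall>v. ?G v \<longrightarrow> card (set v) \<le> card (set w)"
    using Lattices_Big.ex_has_greatest_nat[of ?G xs "\<lambda>w. card (set w)" "Suc (card \<Sigma>)"] by blast
  have sub: "d \<subseteq> set w" using w xs(1) by auto
  have full: "\<Sigma> \<subseteq> set w"
  proof (rule ccontr)
    assume "\<not> \<Sigma> \<subseteq> set w"
    then obtain y where y: "y \<in> \<Sigma>" "y \<notin> set w" by auto
    obtain x where x: "x \<in> d" using d by auto
    \<comment> \<open>A path in the dependence graph from the clique to a missing letter leaves the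
      letters of \<open>w\<close> by some edge from \<open>p\<close> to \<open>q\<close>, and
      \<open>q\<close> can be appended.\<close>
    have "(x, y) \<in> D\<^sup>*"
      using irr x y d(1) by (auto simp: irreducible_trace_monoid_def D_def clique_set_def)
    then obtain p q where pq: "(p, q) \<in> D" "p \<in> set w" "q \<notin> set w"
      using rtrancl_exit[of x y D "set w"] x sub y by blast
    have "\<exists>b. (a, b) \<in> D \<and> b \<noteq> a \<and> proj a b (w @ [q]) \<noteq> [] \<and> hd (proj a b (w @ [q])) = b"
      if a: "a \<in> set (w @ [q]) - d" for a
    proof (cases "a = q")
      case True
      have ne: "proj q p w \<noteq> []" using pq by (simp add: proj_eq_Nil_iff)
      have "set (proj q p w) \<subseteq> {p}" using pq by (auto simp: set_proj)
      then have "hd (proj q p w) = p" using ne hd_in_set by blast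
      then have "proj a p (w @ [q]) \<noteq> []" "hd (proj a p (w @ [q])) = p" using ne True by simp_all
      moreover have "(a, p) \<in> D" "p \<noteq> a" using pq True D_sym[of p q] by auto
      ultimately show ?thesis by blast
    next
      case False
      then have "a \<in> set w - d" using a by auto
      then obtain b where "(a, b) \<in> D" "b \<noteq> a" "proj a b w \<noteq> []" "hd (proj a b w) = b"
        using w by blast
      then show ?thesis by (intro exI[of _ b]) simp
    qed
    moreover have "w @ [q] \<in> lists \<Sigma>" using w pq D_letters by auto
    moreover have "\<exists>r. w @ [q] = xs @ r" using w by auto
    ultimately have "card (set (w @ [q])) \<le> card (set w)" using max by blast
    then show False using pq by simp
  qed
  have wl: "w \<in> lists \<Sigma>" using w by blast
  obtain r where r: "w = xs @ r" using w by blast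
  then have "T w = clique_trace d \<otimes>\<^bsub>M\<^esub> T r" "T r \<in> carrier M" using xs wl by (auto simp: mult_T)
  then have "clique_trace d divides\<^bsub>M\<^esub> T w" using d by simp
  moreover have False
    if a: "a \<in> \<Sigma>" "\<forall>y\<in>d. (a, y) \<in> I" and x: "x \<in> carrier M"
      "T w divides\<^bsub>M\<^esub> x" "clique_trace d \<otimes>\<^bsub>M\<^esub> T [a] divides\<^bsub>M\<^esub> x" for a x
  proof -
    have ad: "a \<notin> d" using a I_neq by blast
    then obtain b where b: "(a, b) \<in> D" "b \<noteq> a" "proj a b w \<noteq> []" "hd (proj a b w) = b"
      using w full a(1) by blast
    \<comment> \<open>\<open>b\<close> depends on \<open>a\<close>, so it is not in the clique,
      which therefore leaves no letter in the projection to the two. The projection of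
      \<open>x\<close> would have to begin both with \<open>a\<close> and with
      \<open>b\<close>.\<close>
    have nbd: "b \<notin> d" using a(2) b(1) by (auto simp: D_def)
    obtain x' where x': "x' \<in> lists \<Sigma>" "x = T x'" using x(1) carrierE by metis
    have "proj_le w x'" "proj_le (xs @ [a]) x'" using x x' xs wl a by (auto simp: divides_iff mult_T)
    then have 1: "prefix (proj a b w) (proj a b x')" "prefix (proj a b (xs @ [a])) (proj a b x')"
      using proj_le_D b(1) by blast+
    have "proj a b xs = []" using ad nbd xs(1) by (simp add: proj_eq_Nil_iff)
    then have "hd (proj a b x') = a" using 1(2) by (auto simp: prefix_def)
    moreover have "hd (proj a b x') = b" using 1(1) b(3,4) by (auto simp: prefix_def)
    ultimately show False using b(2) by simp
  qed
  ultimately show ?thesis using wl T_carrier by blast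
qed

lemma sets_boundary_space:
  "sets (boundary_space \<Sigma> I) = sigma_sets (boundary \<Sigma> I) (cylinder \<Sigma> I ` carrier M)"
  "space (boundary_space \<Sigma> I) = boundary \<Sigma> I"
proof -
  have "cylinder \<Sigma> I ` carrier M \<subseteq> Pow (boundary \<Sigma> I)" using cylinder_boundary by blast
  then show "sets (boundary_space \<Sigma> I) = sigma_sets (boundary \<Sigma> I) (cylinder \<Sigma> I ` carrier M)"
    "space (boundary_space \<Sigma> I) = boundary \<Sigma> I"
    by (simp_all add: boundary_space_def)
qed

lemma bernoulli_moebius:
  assumes irr: "irreducible_trace_monoid \<Sigma> I" and P: "bernoulli_measure \<Sigma> I P"
  shows "moebius_valuation \<Sigma> I (\<lambda>u. measure P (cylinder \<Sigma> I u))"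
proof -
  let ?f = "\<lambda>u. measure P (cylinder \<Sigma> I u)" and ?\<phi> = "\<lambda>a. measure P (cylinder \<Sigma> I (T [a]))"
  have f: "valuation \<Sigma> I ?f" using P by (simp add: bernoulli_measure_def valuation_def)
  interpret prob_space P using P by (simp add: bernoulli_measure_def)
  have cyl: "cylinder \<Sigma> I u \<in> sets P" if "u \<in> carrier M" for u
    using P that by (auto simp: bernoulli_measure_def sets_boundary_space)
  \<comment> \<open>The bound \<open>K\<close> leaves room for one more occurrence of every letter
    after \<open>v\<close>, so that every set of letters is admissible as \<open>N\<close>.\<close>
  have ie: "measure P (cylinder \<Sigma> I v - (\<Union>a\<in>N. cylinder \<Sigma> I (v \<otimes>\<^bsub>M\<^esub> T [a]))) = ?f v * clique_poly ?\<phi> N"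
    if "v \<in> carrier M" "N \<subseteq> \<Sigma>" for v N
    by (rule measure_minus_clique_poly[OF f, where K = "\<lambda>a. Suc (letter_count v a)"])
      (use that cyl cylinder_mono cylinder_directed finite_measure_axioms in \<open>auto simp: bounded_traces_def\<close>)
  have "moebius_transform \<Sigma> I ?f \<one>\<^bsub>M\<^esub> = ?f \<one>\<^bsub>M\<^esub> * clique_poly ?\<phi> \<Sigma>"
    using moebius_one[OF f] valuation_one[OF f] by simp
  also have "\<dots> = measure P (boundary \<Sigma> I - (\<Union>a\<in>\<Sigma>. cylinder \<Sigma> I (T [a])))"
    using ie[OF M_one_closed subset_refl] by (simp add: cylinder_one)
  also have "boundary \<Sigma> I - (\<Union>a\<in>\<Sigma>. cylinder \<Sigma> I (T [a])) = {}" using boundary_letter by blast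
  finally have 0: "moebius_transform \<Sigma> I ?f \<one>\<^bsub>M\<^esub> = 0" by simp
  have "moebius_transform \<Sigma> I ?f c > 0" if c: "c \<in> trace_cliques \<Sigma> I - {\<one>\<^bsub>M\<^esub>}" for c
  proof -
    obtain d where d: "clique_set d" "c = clique_trace d" "d \<noteq> {}"
      using c clique_trace_empty unfolding trace_cliques_eq by blast
    let ?N = "{a \<in> \<Sigma>. \<forall>x\<in>d. (a, x) \<in> I}"
    let ?A = "cylinder \<Sigma> I (clique_trace d) - (\<Union>a\<in>?N. cylinder \<Sigma> I (clique_trace d \<otimes>\<^bsub>M\<^esub> T [a]))"
    obtain u where u: "u \<in> carrier M" "clique_trace d divides\<^bsub>M\<^esub> u"
      "\<And>a x. a \<in> ?N \<Longrightarrow> x \<in> carrier M \<Longrightarrow> u divides\<^bsub>M\<^esub> x \<Longrightarrow> \<not> clique_trace d \<otimes>\<^bsub>M\<^esub> T [a] divides\<^bsub>M\<^esub> x"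
      using blocking_trace[OF irr d(1,3)] by blast
    \<comment> \<open>A point in the cylinder of \<open>u\<close> and in a removed one would give a
      common upper bound, which the choice of \<open>u\<close> excludes.\<close>
    have "cylinder \<Sigma> I u \<subseteq> ?A"
    proof
      fix \<xi> assume x: "\<xi> \<in> cylinder \<Sigma> I u"
      moreover have "\<xi> \<notin> cylinder \<Sigma> I (clique_trace d \<otimes>\<^bsub>M\<^esub> T [a])" if "a \<in> ?N" for a
      proof
        have "clique_trace d \<otimes>\<^bsub>M\<^esub> T [a] \<in> carrier M" using d that by simp
        moreover assume "\<xi> \<in> cylinder \<Sigma> I (clique_trace d \<otimes>\<^bsub>M\<^esub> T [a])"
        ultimately show False using cylinder_directed[OF u(1) _ x] u(3)[OF that] by blast
      qed
      ultimately show "\<xi> \<in> ?A" using cylinder_mono[OF _ u(1,2)] d by auto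
    qed
    moreover have "?A \<in> sets P"
      using d finite_letters cyl by (intro sets.Diff sets.finite_UN) auto
    ultimately have "measure P (cylinder \<Sigma> I u) \<le> measure P ?A" by (rule finite_measure_mono)
    moreover have "measure P (cylinder \<Sigma> I u) > 0" using P u(1) by (simp add: bernoulli_measure_def)
    moreover have "measure P ?A = moebius_transform \<Sigma> I ?f c"
      using ie[of "clique_trace d" ?N] moebius_clique_trace[OF f d(1)] d by simp
    ultimately show ?thesis by simp
  qed
  then show ?thesis using f 0 by (auto simp: moebius_valuation_def)
qed

section \<open>Uniqueness from the values on cylinders\<close>

lemma bernoulli_unique:
  assumes "bernoulli_measure \<Sigma> I P" "bernoulli_measure \<Sigma> I Q"
    and eq: "\<And>u. u \<in> carrier M \<Longrightarrow> measure P (cylinder \<Sigma> I u) = measure Q (cylinder \<Sigma> I u)"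
  shows "P = Q"
proof -
  interpret P: prob_space P using assms by (simp add: bernoulli_measure_def)
  interpret Q: prob_space Q using assms by (simp add: bernoulli_measure_def)
  \<comment> \<open>The empty set is added because traces without common upper bound have disjoint
    cylinders.\<close>
  let ?G = "insert {} (cylinder \<Sigma> I ` carrier M)"
  have sig: "sigma_sets (boundary \<Sigma> I) ?G = sigma_sets (boundary \<Sigma> I) (cylinder \<Sigma> I ` carrier M)"
    by (rule sigma_sets_eqI) (auto intro: sigma_sets.Empty sigma_sets.Basic)
  show ?thesis
  proof (rule measure_eqI_generator_eq[where E = ?G and \<Omega> = "boundary \<Sigma> I" and A = "\<lambda>_. boundary \<Sigma> I"])
    show "Int_stable ?G"
    proof (rule Int_stableI)
      fix A B assume "A \<in> ?G" "B \<in> ?G"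
      then show "A \<inter> B \<in> ?G" using cylinder_Int by blast
    qed
    show "?G \<subseteq> Pow (boundary \<Sigma> I)" using cylinder_boundary by blast
    show "emeasure P X = emeasure Q X" if "X \<in> ?G" for X
      using that eq by (auto simp: P.emeasure_eq_measure Q.emeasure_eq_measure)
    show "sets P = sigma_sets (boundary \<Sigma> I) ?G" "sets Q = sigma_sets (boundary \<Sigma> I) ?G"
      using assms by (simp_all add: bernoulli_measure_def sig sets_boundary_space)
    show "range (\<lambda>_::nat. boundary \<Sigma> I) \<subseteq> ?G" using cylinder_one M_one_closed by blast
  qed auto
qed

end

section \<open>Construction of the Bernoulli measure\<close>

text \<open>Kolmogorov's extension theorem for a sequence of truncations; the values are encoded as
  natural numbers because that theorem is only available for Polish spaces.\<close>

lemma projective_limit_pmf: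
  fixes Q :: "nat \<Rightarrow> 'b pmf" and t :: "nat \<Rightarrow> 'b \<Rightarrow> 'b"
  assumes cons: "\<And>m n. m \<le> n \<Longrightarrow> map_pmf (t m) (Q n) = Q m"
    and tt: "\<And>i m n y. i \<le> m \<Longrightarrow> m \<le> n \<Longrightarrow> y \<in> set_pmf (Q n) \<Longrightarrow> t i (t m y) = t i y"
  obtains L :: "(nat \<Rightarrow> nat discrete) measure" and X :: "nat \<Rightarrow> (nat \<Rightarrow> nat discrete) \<Rightarrow> 'b"
    where "prob_space L" "\<And>n. X n \<in> measurable L (count_space UNIV)"
      "\<And>n. distr L (count_space UNIV) (X n) = measure_pmf (Q n)"
      "\<And>m n. m \<le> n \<Longrightarrow> AE \<omega> in L. X m \<omega> = t m (X n \<omega>)"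
proof -
  \<comment> \<open>The supports together form a countable set; \<open>enc\<close> can be inverted
    only on \<open>B\<close>, so all decoded values have to be shown to lie there.\<close>
  define B where "B = (\<Union>n. set_pmf (Q n))"
  have cB: "countable B" by (auto simp: B_def)
  define enc where "enc y = discrete (to_nat_on B y)" for y
  define dec where "dec x = from_nat_into B (of_discrete x)" for x
  have dec_enc: "dec (enc y) = y" if "y \<in> B" for y
    using that cB by (simp add: dec_def enc_def discrete_inverse)
  have tB: "t i y \<in> B" if "i \<le> n" "y \<in> set_pmf (Q n)" for i n y
    using that cons[OF that(1), symmetric] by (auto simp: B_def intro!: exI[of _ i])
  \<comment> \<open>Inserting \<open>0\<close> gives a value for the empty set. The marginal
    \<open>R J\<close> below samples at level \<open>N J\<close> and truncates the result to each
    index in \<open>J\<close>.\<close>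
  define N where "N J = Max (insert 0 J)" for J :: "nat set"
  have N_ge: "i \<le> N J" if "finite J" "i \<in> J" for i J using that by (auto simp: N_def)
  have N_mono: "N J \<le> N H" if "J \<subseteq> H" "finite H" for J H
    using that by (auto simp: N_def intro!: Max_mono)
  define g where "g J y = (\<lambda>i\<in>J. enc (t i y))" for J y
  have g_meas [measurable]: "g J \<in> measurable (measure_pmf p) (PiM J (\<lambda>_. borel))" for J p
    by (auto simp: g_def space_PiM)
  define R where "R J = distr (measure_pmf (Q (N J))) (PiM J (\<lambda>_. borel)) (g J)" for J
  interpret polish_projective UNIV R
  proof (rule polish_projective.intro, rule projective_family.intro)
    fix J H :: "nat set" assume JH: "J \<subseteq> H" "finite H" "H \<subseteq> UNIV"
    have fJ: "finite J" using JH finite_subset by blast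
    \<comment> \<open>A sample at level \<open>N J\<close> is a truncated sample at the higher level
      \<open>N H\<close>, by \<open>cons\<close>; by \<open>tt\<close> this intermediate truncation
      does not change the coordinates in \<open>J\<close>.\<close>
    have "R J = distr (distr (measure_pmf (Q (N H))) (count_space UNIV) (t (N J)))
        (PiM J (\<lambda>_. borel)) (g J)"
      using cons[OF N_mono[OF JH(1,2)]] by (simp add: R_def map_pmf_rep_eq[symmetric])
    also have "\<dots> = distr (measure_pmf (Q (N H))) (PiM J (\<lambda>_. borel)) (g J \<circ> t (N J))"
      by (rule distr_distr) (auto simp: g_def space_PiM)
    also have "\<dots> = distr (measure_pmf (Q (N H))) (PiM J (\<lambda>_. borel)) ((\<lambda>x. restrict x J) \<circ> g H)"
    proof (rule distr_cong_AE)
      show "AE y in measure_pmf (Q (N H)). (g J \<circ> t (N J)) y = ((\<lambda>x. restrict x J) \<circ> g H) y"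
      proof (rule AE_pmfI)
        fix y assume y: "y \<in> set_pmf (Q (N H))"
        have "t i (t (N J) y) = t i y" if "i \<in> J" for i
          using tt[OF N_ge[OF fJ that] N_mono[OF JH(1,2)] y] .
        then show "(g J \<circ> t (N J)) y = ((\<lambda>x. restrict x J) \<circ> g H) y"
          using JH by (auto simp: g_def fun_eq_iff restrict_def)
      qed
    qed (auto simp: g_def space_PiM)
    also have "\<dots> = distr (R H) (PiM J (\<lambda>_. borel)) (\<lambda>x. restrict x J)"
      unfolding R_def
      by (rule distr_distr[symmetric]) (use JH in \<open>auto intro!: measurable_restrict_subset simp: g_def space_PiM\<close>)
    finally show "R J = distr (R H) (PiM J (\<lambda>_. borel)) (\<lambda>x. restrict x J)" .
  next
    fix J :: "nat set"
    show "prob_space (R J)" unfolding R_def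
      by (rule measure_pmf.prob_space_distr[OF g_meas])
  qed
  have restr [measurable]: "(\<lambda>\<omega>. restrict \<omega> J) \<in> measurable lim (PiM J (\<lambda>_. borel))" for J
    using measurable_restrict_subset[of J UNIV] by (simp cong: measurable_cong_sets)
  have marg: "distr lim (PiM J (\<lambda>_. borel)) (\<lambda>\<omega>. restrict \<omega> J) = R J" if "finite J" for J
  proof (rule measure_eqI)
    show "sets (distr lim (PiM J (\<lambda>_. borel)) (\<lambda>\<omega>. restrict \<omega> J)) = sets (R J)"
      by (simp add: R_def)
    fix A assume "A \<in> sets (distr lim (PiM J (\<lambda>_. borel)) (\<lambda>\<omega>. restrict \<omega> J))"
    then have A: "A \<in> sets (PiM J (\<lambda>_. borel))" by simp
    have "emeasure (distr lim (PiM J (\<lambda>_. borel)) (\<lambda>\<omega>. restrict \<omega> J)) A =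
        emeasure lim (emb UNIV J A)"
      using A by (simp add: emeasure_distr prod_emb_def space_PiM)
    also have "\<dots> = emeasure (R J) A" using A that by (simp add: emeasure_lim_emb)
    finally show "emeasure (distr lim (PiM J (\<lambda>_. borel)) (\<lambda>\<omega>. restrict \<omega> J)) A = emeasure (R J) A" .
  qed
  \<comment> \<open>Every subset of \<open>nat discrete\<close> is Borel, so coordinates remain
    measurable when composed with arbitrary maps such as decoding.\<close>
  have comp: "(\<lambda>x. x i) \<in> measurable (PiM J (\<lambda>_. borel :: nat discrete measure)) (count_space UNIV)"
    if "i \<in> J" for i :: nat and J
  proof -
    have "measurable (PiM J (\<lambda>_. borel)) (borel :: nat discrete measure) =
        measurable (PiM J (\<lambda>_. borel)) (count_space UNIV)"
      by (rule measurable_cong_sets) (simp_all add: sets_borel_eq_count_space)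
    then show ?thesis
      using measurable_component_singleton[OF that, of "\<lambda>_. borel :: nat discrete measure"] by blast
  qed
  define X where "X n \<omega> = dec (\<omega> n)" for n and \<omega> :: "nat \<Rightarrow> nat discrete"
  have dec_meas: "(\<lambda>x. dec (x i)) \<in> measurable (PiM J (\<lambda>_. borel)) (count_space UNIV)"
    if "i \<in> J" for i :: nat and J
    by (rule measurable_compose[OF comp[OF that]]) simp
  have X_meas: "X n \<in> measurable lim (count_space UNIV)" for n
    using dec_meas[of n UNIV] measurable_cong_sets[OF sets_lim HOL.refl]
    unfolding X_def by blast
  have X_distr: "distr lim (count_space UNIV) (X n) = measure_pmf (Q n)" for n
  proof -
    have "distr lim (count_space UNIV) (X n) =
        distr lim (count_space UNIV) ((\<lambda>x. dec (x n)) \<circ> (\<lambda>\<omega>. restrict \<omega> {n}))"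
      by (simp add: X_def[abs_def] comp_def)
    also have "\<dots> = distr (R {n}) (count_space UNIV) (\<lambda>x. dec (x n))"
      using marg[of "{n}"] distr_distr[OF dec_meas[of n "{n}"] restr[of "{n}"]] by simp
    also have "\<dots> = distr (measure_pmf (Q n)) (count_space UNIV) ((\<lambda>x. dec (x n)) \<circ> g {n})"
      unfolding R_def using distr_distr[OF dec_meas[of n "{n}"] g_meas] by (simp add: N_def)
    also have "\<dots> = measure_pmf (map_pmf (\<lambda>y. dec (enc (t n y))) (Q n))"
      by (simp add: map_pmf_rep_eq g_def comp_def)
    \<comment> \<open>Decoding inverts encoding on \<open>B\<close>; the remaining
      \<open>t n\<close> preserves \<open>Q n\<close>, the case \<open>m = n\<close> of
      \<open>cons\<close>.\<close>
    also have "map_pmf (\<lambda>y. dec (enc (t n y))) (Q n) = map_pmf (t n) (Q n)"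
      by (rule map_pmf_cong) (auto intro: dec_enc tB)
    finally show ?thesis using cons[of n n] by simp
  qed
  have X_AE: "AE \<omega> in lim. X m \<omega> = t m (X n \<omega>)" if mn: "m \<le> n" for m n
  proof -
    let ?J = "{m, n}"
    have N: "N ?J = n" using mn by (simp add: N_def)
    have "Measurable.pred (PiM ?J (\<lambda>_. borel)) (\<lambda>x. dec (x m) = t m (dec (x n)))"
    \<comment> \<open>Measurability is checked separately for each of the countably many values of
      coordinate \<open>m\<close>.\<close>
    proof (rule measurable_compose_countable[where f = "\<lambda>k x. dec k = t m (dec (x n))"])
      show "Measurable.pred (PiM ?J (\<lambda>_. borel)) (\<lambda>x. dec k = t m (dec (x n)))" for k
        by (rule measurable_compose[OF comp[of n ?J]]) simp_all
    qed (rule comp, simp)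
    then have meas: "{x \<in> space (PiM ?J (\<lambda>_. borel)). dec (x m) = t m (dec (x n))}
        \<in> sets (PiM ?J (\<lambda>_. borel))" by (simp add: pred_def)
    \<comment> \<open>The relation involves two coordinates only, and for samples from
      \<open>R ?J\<close> it is the identity \<open>tt\<close>.\<close>
    have "AE x in R ?J. dec (x m) = t m (dec (x n))"
      unfolding R_def N
    proof (subst AE_distr_iff[OF g_meas meas], rule AE_pmfI)
      fix y assume y: "y \<in> set_pmf (Q n)"
      then show "dec (g ?J y m) = t m (dec (g ?J y n))"
        using tt[OF mn order_refl y] tB[OF mn y] tB[OF order_refl y] by (simp add: g_def dec_enc)
    qed
    then have "AE \<omega> in lim. dec (restrict \<omega> ?J m) = t m (dec (restrict \<omega> ?J n))"
      unfolding marg[of ?J, simplified, symmetric] by (rule AE_distrD[OF restr])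
    then show ?thesis by (simp add: X_def)
  qed
  show thesis by (rule that[OF P.prob_space_axioms X_meas X_distr X_AE])
qed

section \<open>Consistent distributions on bounded traces\<close>

context independence_pair
begin

text \<open>If the truncation were a proper multiple of \<open>y\<close>, the first letter of the
  quotient would still be below its bound. The fibres of truncation thus have the shape required by
  \<open>measure_minus_clique_poly\<close>.\<close>

lemma trunc_eq_iff:
  assumes x: "x \<in> carrier M" and y: "y \<in> bounded_traces K"
  shows "trunc K x = y \<longleftrightarrow>
    y divides\<^bsub>M\<^esub> x \<and> (\<forall>a\<in>{a \<in> \<Sigma>. letter_count y a < K a}. \<not> y \<otimes>\<^bsub>M\<^esub> T [a] divides\<^bsub>M\<^esub> x)"
proof -
  let ?s = "trunc K x"
  have yc: "y \<in> carrier M" using y bounded_traces_carrier by blast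
  have s: "?s \<in> bounded_traces K" "?s \<in> carrier M" "?s divides\<^bsub>M\<^esub> x"
    using trunc_bounded_traces[OF x] trunc_divides[OF x] bounded_traces_carrier by blast+
  show ?thesis
  proof
    assume eq: "?s = y"
    have "\<not> y \<otimes>\<^bsub>M\<^esub> T [a] divides\<^bsub>M\<^esub> x" if a: "a \<in> \<Sigma>" "letter_count y a < K a" for a
    proof
      assume "y \<otimes>\<^bsub>M\<^esub> T [a] divides\<^bsub>M\<^esub> x"
      moreover have "y \<otimes>\<^bsub>M\<^esub> T [a] \<in> bounded_traces K" using a y yc by (auto simp: bounded_traces_def letter_count_mult letter_count_T)
      ultimately have "y \<otimes>\<^bsub>M\<^esub> T [a] divides\<^bsub>M\<^esub> y" using trunc_greatest[OF x] eq by metis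
      then have "trace_length (y \<otimes>\<^bsub>M\<^esub> T [a]) \<le> trace_length y" using divides_length a yc by simp
      then show False using a yc by (simp add: trace_length_mult)
    qed
    then show "y divides\<^bsub>M\<^esub> x \<and> (\<forall>a\<in>{a \<in> \<Sigma>. letter_count y a < K a}. \<not> y \<otimes>\<^bsub>M\<^esub> T [a] divides\<^bsub>M\<^esub> x)"
      using s(3) eq by blast
  next
    assume R: "y divides\<^bsub>M\<^esub> x \<and> (\<forall>a\<in>{a \<in> \<Sigma>. letter_count y a < K a}. \<not> y \<otimes>\<^bsub>M\<^esub> T [a] divides\<^bsub>M\<^esub> x)"
    then have "y divides\<^bsub>M\<^esub> ?s" using trunc_greatest[OF x y] by blast
    then obtain z where z: "z \<in> carrier M" "?s = y \<otimes>\<^bsub>M\<^esub> z" by (auto simp: factor_def)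
    obtain w where w: "w \<in> lists \<Sigma>" "z = T w" using z carrierE by metis
    show "?s = y"
    proof (cases w)
      case Nil then show ?thesis using z w yc by (simp add: one_M[symmetric])
    next
      case (Cons a w')
      then have a: "a \<in> \<Sigma>" and w': "w' \<in> lists \<Sigma>" and zz: "z = T [a] \<otimes>\<^bsub>M\<^esub> T w'"
        using w by (auto simp: mult_T)
      have eq: "?s = (y \<otimes>\<^bsub>M\<^esub> T [a]) \<otimes>\<^bsub>M\<^esub> T w'" using z(2) zz a w' yc by (simp add: M_assoc)
      have yac: "y \<otimes>\<^bsub>M\<^esub> T [a] \<in> carrier M" using yc a by simp
      have d: "y \<otimes>\<^bsub>M\<^esub> T [a] divides\<^bsub>M\<^esub> ?s" unfolding eq using yac w' by simp
      have "letter_count (y \<otimes>\<^bsub>M\<^esub> T [a]) a \<le> letter_count ?s a" by (rule letter_count_mono[OF yac s(2) d])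
      also have "\<dots> \<le> K a" using s(1) a by (simp add: bounded_traces_def)
      finally have "letter_count y a < K a" using yc a by (simp add: letter_count_mult letter_count_T)
      moreover have "y \<otimes>\<^bsub>M\<^esub> T [a] divides\<^bsub>M\<^esub> x" using M_divides_trans[OF d s(3) yac] .
      ultimately show ?thesis using R a by blast
    qed
  qed
qed

definition trace_pmf :: "('a list set \<Rightarrow> real) \<Rightarrow> nat \<Rightarrow> 'a list set pmf" where
  "trace_pmf f n = embed_pmf (\<lambda>y. if y \<in> bounded_traces (\<lambda>_. n)
    then f y * clique_poly (\<lambda>a. f (T [a])) {a \<in> \<Sigma>. letter_count y a < n} else 0)"

text \<open>The weights are non-negative by \<open>clique_poly_nonneg\<close> and add up to 1 by
  \<open>sum_bounded_traces_clique_poly\<close>.\<close>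

lemma pmf_trace_pmf:
  assumes f: "moebius_valuation \<Sigma> I f"
  shows "pmf (trace_pmf f n) y = (if y \<in> bounded_traces (\<lambda>_. n)
    then f y * clique_poly (\<lambda>a. f (T [a])) {a \<in> \<Sigma>. letter_count y a < n} else 0)"
  unfolding trace_pmf_def
proof (rule pmf_embed_pmf)
  let ?h = "\<lambda>y. if y \<in> bounded_traces (\<lambda>_. n)
    then f y * clique_poly (\<lambda>a. f (T [a])) {a \<in> \<Sigma>. letter_count y a < n} else 0"
  have v: "valuation \<Sigma> I f" using f by (simp add: moebius_valuation_def)
  have pos: "f y > 0" if "y \<in> bounded_traces K" for y K using v that bounded_traces_carrier by (auto simp: valuation_def)
  show nn: "0 \<le> ?h y" for y
    using mult_nonneg_nonneg[OF less_imp_le[OF pos] clique_poly_nonneg[OF f]] by simp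
  have "(\<integral>\<^sup>+y. ennreal (?h y) \<partial>count_space UNIV) = (\<Sum>y\<in>bounded_traces (\<lambda>_. n). ennreal (?h y))"
    by (rule nn_integral_count_space') (auto simp: finite_bounded_traces)
  also have "\<dots> = ennreal (\<Sum>y\<in>bounded_traces (\<lambda>_. n). ?h y)" by (rule sum_ennreal) (rule nn)
  also have "(\<Sum>y\<in>bounded_traces (\<lambda>_. n). ?h y) = 1" using sum_bounded_traces_clique_poly[OF v, of "\<lambda>_. n"] by simp
  finally show "(\<integral>\<^sup>+y. ennreal (?h y) \<partial>count_space UNIV) = 1" by simp
qed

lemma set_trace_pmf:
  assumes "moebius_valuation \<Sigma> I f" shows "set_pmf (trace_pmf f n) \<subseteq> bounded_traces (\<lambda>_. n)"
  by (auto simp: set_pmf_eq pmf_trace_pmf[OF assms] split: if_splits)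

lemma measure_trace_pmf_ge:
  assumes f: "moebius_valuation \<Sigma> I f" and u: "u \<in> bounded_traces (\<lambda>_. n)"
  shows "measure (trace_pmf f n) {y \<in> carrier M. u divides\<^bsub>M\<^esub> y} = f u"
proof -
  have v: "valuation \<Sigma> I f" using f by (simp add: moebius_valuation_def)
  have "measure (trace_pmf f n) {y \<in> carrier M. u divides\<^bsub>M\<^esub> y} =
      measure (trace_pmf f n) {y. y \<in> bounded_traces (\<lambda>_. n) \<and> u divides\<^bsub>M\<^esub> y}"
    using set_trace_pmf[OF f, of n] bounded_traces_carrier by (intro measure_pmf.finite_measure_eq_AE AE_pmfI) auto
  also have "\<dots> = (\<Sum>y | y \<in> bounded_traces (\<lambda>_. n) \<and> u divides\<^bsub>M\<^esub> y. pmf (trace_pmf f n) y)"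
    by (rule measure_measure_pmf_finite) (use finite_bounded_traces in auto)
  also have "\<dots> = f u"
    unfolding sum_bounded_traces_clique_poly_ge[OF v u, symmetric] by (intro sum.cong) (auto simp: pmf_trace_pmf[OF f])
  finally show ?thesis .
qed

text \<open>At level \<open>n\<close> the multiples of a trace \<open>u\<close> bounded by
  \<open>m\<close> have probability \<open>f u\<close>. Inclusion-exclusion computes from these
  values the probability of a fibre of truncation, and the result does not depend on
  \<open>n\<close>.\<close>

lemma map_trunc_trace_pmf:
  assumes f: "moebius_valuation \<Sigma> I f" and mn: "m \<le> n"
  shows "map_pmf (trunc (\<lambda>_. m)) (trace_pmf f n) = trace_pmf f m"
proof (rule pmf_eqI)
  fix y
  let ?E = "\<lambda>u. {y \<in> carrier M. u divides\<^bsub>M\<^esub> y}"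
  have v: "valuation \<Sigma> I f" using f by (simp add: moebius_valuation_def)
  have sub: "bounded_traces (\<lambda>_. m) \<subseteq> bounded_traces (\<lambda>_. n)" using mn by (intro bounded_traces_mono) (simp add: le_fun_def)
  have car: "x \<in> carrier M" if "x \<in> set_pmf (trace_pmf f n)" for x
    using set_trace_pmf[OF f] bounded_traces_carrier that by blast
  show "pmf (map_pmf (trunc (\<lambda>_. m)) (trace_pmf f n)) y = pmf (trace_pmf f m) y"
  proof (cases "y \<in> bounded_traces (\<lambda>_. m)")
    case False
    then have "y \<notin> trunc (\<lambda>_. m) ` set_pmf (trace_pmf f n)" using car trunc_bounded_traces by blast
    then have "pmf (map_pmf (trunc (\<lambda>_. m)) (trace_pmf f n)) y = 0"
      by (simp add: pmf_eq_0_set_pmf)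
    then show ?thesis using False by (simp add: pmf_trace_pmf[OF f])
  next
    case True
    let ?N = "{a \<in> \<Sigma>. letter_count y a < m}"
    have yc: "y \<in> carrier M" using True bounded_traces_carrier by blast
    have "pmf (map_pmf (trunc (\<lambda>_. m)) (trace_pmf f n)) y =
        measure (trace_pmf f n) (trunc (\<lambda>_. m) -` {y})"
      by (simp add: pmf_map)
    also have "\<dots> = measure (trace_pmf f n) (?E y - (\<Union>a\<in>?N. ?E (y \<otimes>\<^bsub>M\<^esub> T [a])))"
      using car trunc_eq_iff[OF _ True] by (intro measure_pmf.finite_measure_eq_AE AE_pmfI) auto
    also have "\<dots> = f y * clique_poly (\<lambda>a. f (T [a])) ?N"
    proof (rule measure_minus_clique_poly[OF v measure_pmf.finite_measure_axioms, where K = "\<lambda>_. m"])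
      show "?E w \<subseteq> ?E u" if "u \<in> carrier M" "u divides\<^bsub>M\<^esub> w" for u w
        using that M_divides_trans by blast
      \<comment> \<open>A sampled trace is itself an upper bound of its divisors.\<close>
      show "\<exists>x\<in>carrier M. u divides\<^bsub>M\<^esub> x \<and> w divides\<^bsub>M\<^esub> x \<and> \<omega> \<in> ?E x"
        if "\<omega> \<in> ?E u" "\<omega> \<in> ?E w" for u w \<omega>
        using that M_divides_refl by blast
      show "measure (trace_pmf f n) (?E u) = f u" if "u \<in> bounded_traces (\<lambda>_. m)" for u
        using measure_trace_pmf_ge[OF f] sub that by blast
    qed (use True in auto)
    finally show ?thesis using True by (simp add: pmf_trace_pmf[OF f])
  qed
qed

section \<open>Passage to the boundary\<close>

lemma bounded_traces_length: "u \<in> carrier M \<Longrightarrow> trace_length u \<le> n \<Longrightarrow> u \<in> bounded_traces (\<lambda>_. n)"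
  by (auto elim!: carrierE simp: bounded_traces_def letter_count_T trace_length_T intro: order_trans[OF count_le_length])

text \<open>The last condition excludes the traces of \<open>carrier M\<close> as limits: the sequence of truncations
  of \<open>x\<close> is \<open>x\<close> from index \<open>trace_length x\<close> on.\<close>

lemma truncations_boundary:
  assumes bnd: "\<And>n. s n \<in> bounded_traces (\<lambda>_. n)"
    and tr: "\<And>m n. m \<le> n \<Longrightarrow> s m = trunc (\<lambda>_. m) (s n)"
    and nc: "\<And>x. x \<in> carrier M \<Longrightarrow> s (Suc (trace_length x)) \<noteq> x"
  shows "s \<in> trace_seqs \<Sigma> I" "seq_class s \<in> boundary \<Sigma> I"
    "u \<in> carrier M \<Longrightarrow> seq_class s \<in> cylinder \<Sigma> I u \<longleftrightarrow> u divides\<^bsub>M\<^esub> s (trace_length u)"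
proof -
  have c: "s n \<in> carrier M" for n using bnd bounded_traces_carrier by blast
  have mono: "s m divides\<^bsub>M\<^esub> s n" if "m \<le> n" for m n
    using trunc_divides[OF c] tr[OF that] by metis
  show S: "s \<in> trace_seqs \<Sigma> I" using c mono by (auto simp: trace_seqs_def monotone_def)
  \<comment> \<open>Whether a trace with counts at most \<open>n\<close> divides some term of the
    sequence is decided at index \<open>n\<close>.\<close>
  have le: "u divides\<^bsub>M\<^esub> s n" if u: "u \<in> bounded_traces (\<lambda>_. n)" "u divides\<^bsub>M\<^esub> s k" for u n k
  proof (cases "k \<le> n")
    case True
    show ?thesis by (rule M_divides_trans[OF u(2) mono[OF True] bounded_traces_carrier[OF u(1)]])
  next
    case False
    then have "s n = trunc (\<lambda>_. n) (s k)" using tr[of n k] by simp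
    then show ?thesis using trunc_greatest[OF c u] by simp
  qed
  show B: "seq_class s \<in> boundary \<Sigma> I"
    unfolding seq_class_in_boundary[OF S]
  proof (intro ballI notI, elim conjE exE)
    fix x k assume x: "x \<in> carrier M" "\<forall>k. s k divides\<^bsub>M\<^esub> x" "x divides\<^bsub>M\<^esub> s k"
    have "x divides\<^bsub>M\<^esub> s (Suc (trace_length x))"
      by (rule le[OF bounded_traces_length[OF x(1)] x(3)]) simp
    then have "s (Suc (trace_length x)) = x" using divides_antisym[OF c x(1)] x(2) by blast
    then show False using nc[OF x(1)] by blast
  qed
  show "seq_class s \<in> cylinder \<Sigma> I u \<longleftrightarrow> u divides\<^bsub>M\<^esub> s (trace_length u)" if "u \<in> carrier M"
    using in_cylinder[OF S that] B le[OF bounded_traces_length[OF that order_refl]] by blast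
qed

lemma moebius_bernoulli:
  assumes f: "moebius_valuation \<Sigma> I f"
  shows "\<exists>P. bernoulli_measure \<Sigma> I P \<and> (\<forall>u\<in>carrier M. measure P (cylinder \<Sigma> I u) = f u)"
proof -
  have v: "valuation \<Sigma> I f" using f by (simp add: moebius_valuation_def)
  have carQ: "y \<in> carrier M" if "y \<in> set_pmf (trace_pmf f n)" for y n
    using that set_trace_pmf[OF f] bounded_traces_carrier by blast
  obtain L :: "(nat \<Rightarrow> nat discrete) measure" and X :: "nat \<Rightarrow> (nat \<Rightarrow> nat discrete) \<Rightarrow> 'a list set"
    where L: "prob_space L" and X: "\<And>n. X n \<in> measurable L (count_space UNIV)"
      and XQ: "\<And>n. distr L (count_space UNIV) (X n) = measure_pmf (trace_pmf f n)"
      and Xt: "\<And>m n. m \<le> n \<Longrightarrow> AE \<omega> in L. X m \<omega> = trunc (\<lambda>_. m) (X n \<omega>)"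
  proof (rule projective_limit_pmf[of "\<lambda>m. trunc (\<lambda>_. m)" "trace_pmf f"])
    show "map_pmf (trunc (\<lambda>_. m)) (trace_pmf f n) = trace_pmf f m" if "m \<le> n" for m n
      using map_trunc_trace_pmf[OF f that] .
    show "trunc (\<lambda>_. i) (trunc (\<lambda>_. m) y) = trunc (\<lambda>_. i) y"
      if "i \<le> m" "m \<le> n" "y \<in> set_pmf (trace_pmf f n)" for i m n y
      by (rule trunc_trunc[OF carQ[OF that(3)]]) (use that(1) in \<open>simp add: le_fun_def\<close>)
  qed (rule that)
  interpret L: prob_space L by (rule L)
  have AE_X: "AE \<omega> in L. Q (X n \<omega>)" if "\<And>y. y \<in> set_pmf (trace_pmf f n) \<Longrightarrow> Q y" for Q n
  proof -
    have "AE y in distr L (count_space UNIV) (X n). Q y" unfolding XQ using that by (rule AE_pmfI)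
    then show ?thesis by (rule AE_distrD[OF X])
  qed
  have "AE \<omega> in L. X n \<omega> \<in> bounded_traces (\<lambda>_. n)" for n
    by (rule AE_X) (use set_trace_pmf[OF f] in blast)
  moreover have "AE \<omega> in L. m \<le> n \<longrightarrow> X m \<omega> = trunc (\<lambda>_. m) (X n \<omega>)" for m n
    by (cases "m \<le> n") (use Xt in auto)
  moreover have "AE \<omega> in L. \<forall>x\<in>carrier M. X (Suc (trace_length x)) \<omega> \<noteq> x"
  proof (rule AE_ball_countable[THEN iffD2, rule_format])
    have "countable (lists \<Sigma>)" using finite_letters countable_finite by blast
    then show "countable (carrier M)" unfolding carrier_M by (rule countable_image)
    fix x assume x: "x \<in> carrier M"
    \<comment> \<open>One more than the length, so that no letter of \<open>x\<close> has reached
      its bound and the weight of \<open>x\<close> contains the factor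
      \<open>m(\<Sigma>) = h(0) = 0\<close>.\<close>
    let ?n = "Suc (trace_length x)"
    have "letter_count x a < ?n" for a
      using x by (auto elim!: carrierE simp: letter_count_T trace_length_T less_Suc_eq_le count_le_length)
    then have "{a \<in> \<Sigma>. letter_count x a < ?n} = \<Sigma>" by blast
    then have "pmf (trace_pmf f ?n) x = 0"
      using f moebius_one[OF v] by (simp add: pmf_trace_pmf[OF f] moebius_valuation_def)
    then show "AE \<omega> in L. X ?n \<omega> \<noteq> x"
      by (intro AE_X) (auto simp: set_pmf_eq)
  qed
  ultimately have "AE \<omega> in L. (\<forall>n. X n \<omega> \<in> bounded_traces (\<lambda>_. n)) \<and>
      (\<forall>m n. m \<le> n \<longrightarrow> X m \<omega> = trunc (\<lambda>_. m) (X n \<omega>)) \<and>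
      (\<forall>x\<in>carrier M. X (Suc (trace_length x)) \<omega> \<noteq> x)"
    by (simp add: AE_all_countable)
  then obtain N where N: "{\<omega> \<in> space L. \<not> ((\<forall>n. X n \<omega> \<in> bounded_traces (\<lambda>_. n)) \<and>
      (\<forall>m n. m \<le> n \<longrightarrow> X m \<omega> = trunc (\<lambda>_. m) (X n \<omega>)) \<and>
      (\<forall>x\<in>carrier M. X (Suc (trace_length x)) \<omega> \<noteq> x))} \<subseteq> N" "emeasure L N = 0" "N \<in> sets L"
    by (rule AE_E)
  \<comment> \<open>On this set of full measure the almost sure relations hold everywhere, so that
    \<open>truncations_boundary\<close> applies pointwise.\<close>
  define S where "S = space L - N"
  have S: "S \<in> sets L" "S \<subseteq> space L" using N by (auto simp: S_def)
  have AE_S: "AE \<omega> in L. \<omega> \<in> S"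
    using AE_not_in[of N L] N(2,3) AE_space[of L] by (auto simp: S_def null_sets_def)
  define \<psi> where "\<psi> \<omega> = seq_class (\<lambda>n. X n \<omega>)" for \<omega>
  have good: "X n \<omega> \<in> bounded_traces (\<lambda>_. n)" "m \<le> n \<Longrightarrow> X m \<omega> = trunc (\<lambda>_. m) (X n \<omega>)"
    "x \<in> carrier M \<Longrightarrow> X (Suc (trace_length x)) \<omega> \<noteq> x" if "\<omega> \<in> S" for \<omega> m n x
    using N(1) that by (auto simp: S_def)
  have \<psi>_boundary: "\<psi> \<omega> \<in> boundary \<Sigma> I" if "\<omega> \<in> S" for \<omega>
    unfolding \<psi>_def using that by (intro truncations_boundary(2) good)
  have \<psi>_cyl: "\<psi> \<omega> \<in> cylinder \<Sigma> I u \<longleftrightarrow> u divides\<^bsub>M\<^esub> X (trace_length u) \<omega>"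
    if "\<omega> \<in> S" "u \<in> carrier M" for \<omega> u
    unfolding \<psi>_def using that by (intro truncations_boundary(3) good)
  \<comment> \<open>At index \<open>trace_length u\<close> the trace \<open>u\<close> is within the
    bounds, so divisibility at this single index decides membership in the cylinder.\<close>
  define E where "E u = X (trace_length u) -` {y \<in> carrier M. u divides\<^bsub>M\<^esub> y} \<inter> space L" for u
  have E_sets: "E u \<in> sets L" for u unfolding E_def by (rule measurable_sets[OF X]) simp
  have XS: "X n \<omega> \<in> carrier M" if "\<omega> \<in> S" for n \<omega> using good(1)[OF that] bounded_traces_carrier by blast
  have vim: "\<psi> -` cylinder \<Sigma> I u \<inter> S = E u \<inter> S" if "u \<in> carrier M" for u
    using \<psi>_cyl[OF _ that] XS S(2) by (auto simp: E_def)
  \<comment> \<open>Only on \<open>S\<close> is \<open>\<psi>\<close> known to take values in the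
    boundary, hence the restriction.\<close>
  define L' where "L' = restrict_space L S"
  have spL': "space L' = S" using S by (auto simp: L'_def space_restrict_space)
  have "emeasure L' (space L') = 1"
    using S L.emeasure_eq_1_AE[OF S(1) AE_S] by (simp add: spL') (simp add: L'_def emeasure_restrict_space)
  then interpret L': prob_space L' by (rule prob_spaceI)
  have \<psi>: "\<psi> \<in> measurable L' (boundary_space \<Sigma> I)"
    unfolding boundary_space_def
  proof (rule measurable_measure_of)
    show "cylinder \<Sigma> I ` carrier M \<subseteq> Pow (boundary \<Sigma> I)" using cylinder_boundary by blast
    show "\<psi> \<in> space L' \<rightarrow> boundary \<Sigma> I" using \<psi>_boundary by (simp add: spL')
    fix A assume "A \<in> cylinder \<Sigma> I ` carrier M"
    then obtain u where "u \<in> carrier M" "A = cylinder \<Sigma> I u" by blast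
    then have "\<psi> -` A \<inter> space L' = E u \<inter> S" using vim by (simp add: spL')
    then show "\<psi> -` A \<inter> space L' \<in> sets L'"
      using E_sets S by (auto simp: L'_def sets_restrict_space)
  qed
  define P where "P = distr L' (boundary_space \<Sigma> I) \<psi>"
  have val: "measure P (cylinder \<Sigma> I u) = f u" if u: "u \<in> carrier M" for u
  proof -
    have "cylinder \<Sigma> I u \<in> sets (boundary_space \<Sigma> I)" using u by (auto simp: sets_boundary_space)
    then have "measure P (cylinder \<Sigma> I u) = measure L' (E u \<inter> S)"
      unfolding P_def using \<psi> vim[OF u] by (simp add: measure_distr spL')
    also have "\<dots> = measure L (E u \<inter> S)"
      unfolding L'_def using S by (intro measure_restrict_space) auto
    also have "\<dots> = measure L (E u)"
      using AE_S E_sets S by (intro L.finite_measure_eq_AE) auto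
    also have "\<dots> = measure (distr L (count_space UNIV) (X (trace_length u)))
        {y \<in> carrier M. u divides\<^bsub>M\<^esub> y}"
      unfolding E_def by (rule measure_distr[OF X, symmetric]) simp
    also have "\<dots> = f u"
      unfolding XQ by (rule measure_trace_pmf_ge[OF f bounded_traces_length[OF u order_refl]])
    finally show ?thesis .
  qed
  have "prob_space P" unfolding P_def by (rule L'.prob_space_distr[OF \<psi>])
  moreover have "space P = space (boundary_space \<Sigma> I)" "sets P = sets (boundary_space \<Sigma> I)"
    by (simp_all add: P_def)
  ultimately have "bernoulli_measure \<Sigma> I P"
    using v val by (simp add: bernoulli_measure_def valuation_def)
  then show ?thesis using val by blast
qed

end

theorem theorem2p4:
  fixes \<Sigma> :: "'a set" and I :: "('a \<times> 'a) set"
  assumes "independence_pair \<Sigma> I"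
    and "irreducible_trace_monoid \<Sigma> I"
  shows "(\<forall>P. bernoulli_measure \<Sigma> I P \<longrightarrow>
            moebius_valuation \<Sigma> I (\<lambda>u. measure P (cylinder \<Sigma> I u))) \<and>
         (\<forall>f. moebius_valuation \<Sigma> I f \<longrightarrow>
            (\<exists>!P. bernoulli_measure \<Sigma> I P \<and>
                  (\<forall>u\<in>carrier (trace_monoid \<Sigma> I). measure P (cylinder \<Sigma> I u) = f u)))"
proof (intro conjI allI impI)
  interpret independence_pair \<Sigma> I by fact
  show "moebius_valuation \<Sigma> I (\<lambda>u. measure P (cylinder \<Sigma> I u))"
    if "bernoulli_measure \<Sigma> I P" for P
    using assms(2) that by (rule bernoulli_moebius)
  show "\<exists>!P. bernoulli_measure \<Sigma> I P \<and>
      (\<forall>u\<in>carrier (trace_monoid \<Sigma> I). measure P (cylinder \<Sigma> I u) = f u)"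
    if f: "moebius_valuation \<Sigma> I f" for f
  proof (rule ex_ex1I)
    show "\<exists>P. bernoulli_measure \<Sigma> I P \<and>
        (\<forall>u\<in>carrier (trace_monoid \<Sigma> I). measure P (cylinder \<Sigma> I u) = f u)"
      using f by (rule moebius_bernoulli)
    show "P = Q"
      if "bernoulli_measure \<Sigma> I P \<and> (\<forall>u\<in>carrier M. measure P (cylinder \<Sigma> I u) = f u)"
        "bernoulli_measure \<Sigma> I Q \<and> (\<forall>u\<in>carrier M. measure Q (cylinder \<Sigma> I u) = f u)" for P Q
      by (rule bernoulli_unique) (use that in auto)
  qed
qed

end
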